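(* Every $5$-tough chordal graph on at least three vertices is Hamilton-connected.
   Context: Graphs are finite and simple. A graph is chordal if every cycle of length at least four has a chord. Let $c(H)$ denote the number of connected components of a graph $H$. For a real number $t$, a graph $G$ is $t$-tough if $|S|\ge t\,c(G-S)$ for every $S\subseteq V(G)$ with $c(G-S)\ge 2$ (so complete graphs are $t$-tough for every $t$). A graph $G$ is Hamilton-connected if for every two distinct vertices $u,v$ of $G$ there is a Hamilton path of $G$ from $u$ to $v$. *)

theory Defs
  imports Complex_Main "Graph_Theory.Graph_Theory"
begin

text \<open>
  A finite simple graph is an element of the locale \<^locale>\<open>graph\<close>: a finite digraph
  without loops and parallel arcs in which every arc has an opposite arc. An undirected
  edge is thus a pair of opposite arcs.
\<close>

text \<open>The components are the maximal connected subgraphs. The qualified name is needed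
  because of the topological predicate of the same name.\<close>

definition components_of :: "('a, 'b) pre_digraph \<Rightarrow> ('a, 'b) pre_digraph set" where
  "components_of G = {C. pre_digraph.max_subgraph G Digraph_Component.connected C}"

definition num_components :: "('a, 'b) pre_digraph \<Rightarrow> nat" where
  "num_components G = card (components_of G)"

definition tough :: "real \<Rightarrow> ('a, 'b) pre_digraph \<Rightarrow> bool" where
  "tough t G \<longleftrightarrow>
    (\<forall>S \<subseteq> verts G. num_components (G \<restriction> (verts G - S)) \<ge> 2 \<longrightarrow>
       real (card S) \<ge> t * real (num_components (G \<restriction> (verts G - S))))"

text \<open>
  Cycles are closed arc walks \<open>p\<close>, so the vertices on \<open>p\<close> are the tails of its arcs.
  A chord joins two of them, and neither it nor its opposite arc is traversed by \<open>p\<close>.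
\<close>

definition chord :: "('a, 'b) pre_digraph \<Rightarrow> 'b list \<Rightarrow> 'a \<Rightarrow> 'a \<Rightarrow> bool" where
  "chord G p u v \<longleftrightarrow>
     u \<in> tail G ` set p \<and> v \<in> tail G ` set p \<and> u \<rightarrow>\<^bsub>G\<^esub> v \<and>
     (u, v) \<notin> arc_to_ends G ` set p \<and> (v, u) \<notin> arc_to_ends G ` set p"

text \<open>In a symmetric digraph \<^const>\<open>pre_digraph.cycle\<close> also admits a pair of opposite arcs;
  the length bound below excludes these.\<close>

definition chordal :: "('a, 'b) pre_digraph \<Rightarrow> bool" where
  "chordal G \<longleftrightarrow> (\<forall>p. pre_digraph.cycle G p \<and> length p \<ge> 4 \<longrightarrow> (\<exists>u v. chord G p u v))"

definition hamilton_path :: "('a, 'b) pre_digraph \<Rightarrow> 'a \<Rightarrow> 'b list \<Rightarrow> 'a \<Rightarrow> bool" where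
  "hamilton_path G u p v \<longleftrightarrow>
     pre_digraph.apath G u p v \<and> set (pre_digraph.awalk_verts G u p) = verts G"

definition hamilton_connected :: "('a, 'b) pre_digraph \<Rightarrow> bool" where
  "hamilton_connected G \<longleftrightarrow>
     (\<forall>u \<in> verts G. \<forall>v \<in> verts G. u \<noteq> v \<longrightarrow> (\<exists>p. hamilton_path G u p v))"

text \<open>For symmetric digraphs the components are the strongly connected components of the
  library.\<close>

lemma (in sym_digraph) components_of_eq_sccs: "components_of G = sccs"
proof -
  have sc: "strongly_connected (G \<restriction> verts H)"
    if H: "subgraph H G" "Digraph_Component.connected H" for H
  proof -
    interpret I: wf_digraph "G \<restriction> verts H" by (rule wellformed_induce_subgraph)
    have "subgraph H (G \<restriction> verts H)"
      using H(1) by (rule subgraph_induce_subgraphI2)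
    then have "spanning H (G \<restriction> verts H)" by (auto simp: spanning_def)
    then have "Digraph_Component.connected (G \<restriction> verts H)"
      using H(2) I.connected_spanning_imp_connected by blast
    moreover have "induced_subgraph (G \<restriction> verts H) G"
      using H(1) by (intro induced_induce) auto
    then have "symmetric (G \<restriction> verts H)"
      using sym_arcs induced_graph_imp_symmetric by blast
    ultimately show ?thesis using I.symmetric_connected_imp_strongly_connected by blast
  qed
  have sc_con: "Digraph_Component.connected H"
    if H: "subgraph H G" "strongly_connected H" for H
  proof -
    interpret H: wf_digraph H using H(1) by auto
    show ?thesis unfolding connected_conv
    proof (intro conjI ballI)
      show "verts H \<noteq> {}" using H(2) by (simp add: strongly_connected_def)
      fix u v assume "u \<in> verts H" "v \<in> verts H"
      then have "(u, v) \<in> rtrancl_on (verts H) (arcs_ends H)"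
        using H(2) by (simp add: strongly_connected_def reachable_def)
      then show "(u, v) \<in> rtrancl_on (verts H) ((arcs_ends H)\<^sup>s)"
        by (rule rtrancl_on_mono[OF _ order_refl, rotated]) (auto simp: symcl_def)
    qed
  qed
  have sub1: "subgraph H (G \<restriction> verts H)" and sub2: "subgraph (G \<restriction> verts H) G"
    if "subgraph H G" for H
    using that by (auto intro: subgraph_induce_subgraphI2 subgraph_induce_subgraphI)
  have maxD: "y = K" if "max_subgraph P K" "subgraph K y" "subgraph y G" "P y" for P K y
    using that by (auto simp: max_subgraph_def)
  show ?thesis unfolding components_of_def sccs_altdef2
  proof (intro Collect_cong iffI)
    fix K assume K: "max_subgraph Digraph_Component.connected K"
    then have KG: "subgraph K G" and Kc: "Digraph_Component.connected K"
      by (auto simp: max_subgraph_def)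
    have "Digraph_Component.connected (G \<restriction> verts K)"
      using sc_con[OF sub2[OF KG] sc[OF KG Kc]] .
    then have eq: "K = G \<restriction> verts K"
      using maxD[OF K sub1[OF KG] sub2[OF KG]] by simp
    show "max_subgraph strongly_connected K"
    proof (rule max_subgraphI)
      show "strongly_connected K" using sc[OF KG Kc] unfolding eq[symmetric] .
      show "subgraph K G" by (rule KG)
      fix y assume y: "K \<noteq> y" "subgraph K y" "subgraph y G"
      show "\<not> strongly_connected y"
        using maxD[OF K y(2,3)] sc_con[OF y(3)] y(1) by blast
    qed
  next
    fix K assume K: "max_subgraph strongly_connected K"
    then have KG: "subgraph K G" and Ks: "strongly_connected K"
      by (auto simp: max_subgraph_def)
    show "max_subgraph Digraph_Component.connected K"
    proof (rule max_subgraphI)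
      show "Digraph_Component.connected K" using sc_con[OF KG Ks] .
      show "subgraph K G" by (rule KG)
      fix y assume y: "K \<noteq> y" "subgraph K y" "subgraph y G"
      show "\<not> Digraph_Component.connected y"
      proof
        assume "Digraph_Component.connected y"
        then have "strongly_connected (G \<restriction> verts y)" using sc y(3) by blast
        moreover have sy: "subgraph K (G \<restriction> verts y)"
          using y(2) sub1[OF y(3)] by (rule subgraph_trans)
        ultimately have "G \<restriction> verts y = K"
          using maxD[OF K _ sub2[OF y(3)]] by blast
        then have "subgraph y K" using sub1[OF y(3)] by simp
        with y(1,2) show False
          by (auto simp: subgraph_def compatible_def)
      qed
    qed
  qed
qed

end

theory Submission imports Defs begin

text \<open>
  Let \<open>a\<close> and \<open>b\<close> be the prescribed ends. Removing simplicial vertices one after the other,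
  and \<open>b\<close> last, numbers the vertices of a chordal graph from \<open>0\<close> to \<open>n - 1\<close> such that the
  later neighbours \<open>N x\<close> of every vertex \<open>x\<close> form a clique (\<open>elimination_ordering_exists\<close>).
  The first later neighbour of \<open>x\<close> is its parent in a tree with root \<open>b\<close>, every edge joins a
  vertex to one of its ancestors, and a subtree with root \<open>x\<close> has no neighbours outside but
  those in \<open>N x\<close>.

  A path is built from the leaves of this tree to the root. On the subtree of \<open>x\<close> it forms a
  segment with two open ends, or one if it starts in \<open>a\<close>. An open end has a position \<open>g\<close>, and
  every vertex of \<open>N g\<close> may continue it. If \<open>x\<close> has one child and can be appended to the
  segment of that child, this is done; then \<open>x\<close> is called passing, and also if it has one
  child and is needed in a slot further down. Otherwise the segments of all children are
  closed: every open end receives a slot, a place to be filled by a later vertex that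
  continues the end, and the segments, now ending in slots, are concatenated. This is possible
  because all vertices that can fill these slots lie in one clique with \<open>x\<close>. Vertices are
  accepted as fillers greedily in the elimination order: one is rejected only if it cannot be
  matched to a slot together with those accepted before it.

  If an accepted vertex is found for every slot, the segments form a Hamilton path from \<open>a\<close> to
  \<open>b\<close> (\<open>spanning_path\<close>). If a slot stays empty, alternating paths from it lead to a set \<open>C\<close> of
  gaps (maximal runs of passing nodes) and one open end in each of them, such that the set \<open>S\<close>
  of all continuations of these ends consists mainly of accepted vertices sitting in slots of
  \<open>C\<close>. There are two slots for each gap, one of them is empty, and \<open>a\<close> and \<open>b\<close> may belong to
  \<open>S\<close> as well; this gives \<open>card S \<le> 2 * card C + 1\<close> (\<open>deficient_cut\<close>). But \<open>S\<close> cuts the tree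
  at \<open>card C\<close> places. A piece of the tree that is swallowed by \<open>S\<close> branches into at least two
  others, with one possible exception at \<open>a\<close>, because a run of passing nodes starts where the
  tree branches or where no continuation is possible. So at least half of the \<open>card C + 1\<close>
  pieces survive (\<open>cut_pieces\<close>), whence \<open>card S\<close> is less than four times the number of
  components, and toughness is violated.
\<close>

section \<open>Elimination orders and their trees\<close>

text \<open>
  \<open>N x\<close> stands for the neighbours of \<open>x\<close> that are eliminated after \<open>x\<close>. The last condition
  expresses connectedness: it makes the first later neighbour a parent function with root
  \<open>n - 1\<close>.
\<close>

locale elimination_order =
  fixes n :: nat and N :: "nat \<Rightarrow> nat set"
  assumes pos: "0 < n"
    and later: "y \<in> N x \<Longrightarrow> x < y \<and> y < n"
    and clique: "y \<in> N x \<Longrightarrow> z \<in> N x \<Longrightarrow> y < z \<Longrightarrow> z \<in> N y"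
    and nonempty: "Suc x < n \<Longrightarrow> N x \<noteq> {}"
begin

definition par :: "nat \<Rightarrow> nat" where "par x = Min (N x)"

definition anc :: "nat \<Rightarrow> nat \<Rightarrow> bool" (infix "\<sqsubseteq>" 50) where
  "x \<sqsubseteq> y \<longleftrightarrow> (x, y) \<in> {(a, par a) |a. Suc a < n}\<^sup>*"

lemma finite_N [simp]: "finite (N x)"
  by (rule finite_subset[of _ "{..<n}"]) (use later in auto)

lemma par_in_N: "Suc x < n \<Longrightarrow> par x \<in> N x"
  unfolding par_def using nonempty by (intro Min_in) auto

lemma par_gt: "Suc x < n \<Longrightarrow> x < par x"
  using par_in_N later by blast

lemma par_lt: "Suc x < n \<Longrightarrow> par x < n"
  using par_in_N later by blast

lemma par_le: "y \<in> N x \<Longrightarrow> par x \<le> y"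
  unfolding par_def by simp

lemma N_par: "z \<in> N x \<Longrightarrow> z \<noteq> par x \<Longrightarrow> z \<in> N (par x)"
proof -
  assume z: "z \<in> N x" "z \<noteq> par x"
  then have "Suc x < n" using later by fastforce
  then show ?thesis using clique[OF par_in_N z(1)] par_le[OF z(1)] z(2) by simp
qed

lemma anc_refl [simp]: "x \<sqsubseteq> x"
  by (simp add: anc_def)

lemma anc_trans [trans]: "x \<sqsubseteq> y \<Longrightarrow> y \<sqsubseteq> z \<Longrightarrow> x \<sqsubseteq> z"
  unfolding anc_def by (rule rtrancl_trans)

lemma anc_par: "Suc x < n \<Longrightarrow> x \<sqsubseteq> par x"
  unfolding anc_def by (rule r_into_rtrancl) auto

lemma anc_le: "x \<sqsubseteq> y \<Longrightarrow> x \<le> y"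
  unfolding anc_def by (induction rule: rtrancl_induct) (auto dest!: par_gt)

lemma anc_antisym: "x \<sqsubseteq> y \<Longrightarrow> y \<sqsubseteq> x \<Longrightarrow> x = y"
  using anc_le by (simp add: order_antisym)

lemma anc_cases:
  assumes "x \<sqsubseteq> y" obtains "x = y" | "Suc x < n" "par x \<sqsubseteq> y"
  using assms unfolding anc_def by (rule converse_rtranclE) auto

lemma anc_child:
  assumes "x \<sqsubseteq> y" "x \<noteq> y" obtains c where "Suc c < n" "par c = y" "x \<sqsubseteq> c"
  using assms(1) unfolding anc_def by (rule rtranclE) (use assms(2) in auto)

lemma anc_linear: "x \<sqsubseteq> y \<Longrightarrow> x \<sqsubseteq> z \<Longrightarrow> y \<sqsubseteq> z \<or> z \<sqsubseteq> y"
proof -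
  assume *: "x \<sqsubseteq> y" "x \<sqsubseteq> z"
  have sv: "single_valued {(a, par a) |a. Suc a < n}" by (auto simp: single_valued_def)
  show ?thesis using single_valued_confluent[OF sv *[unfolded anc_def]] by (auto simp: anc_def)
qed

lemma anc_if_le: "x \<sqsubseteq> y \<Longrightarrow> x \<sqsubseteq> z \<Longrightarrow> y \<le> z \<Longrightarrow> y \<sqsubseteq> z"
  using anc_linear[of x y z] anc_le[of z y] by auto

lemma N_anc: "z \<in> N x \<Longrightarrow> x \<sqsubseteq> z"
proof (induction "z - x" arbitrary: x rule: less_induct)
  case less
  have x: "Suc x < n" "x < z" using later[OF less.prems] by auto
  show ?case
  proof (cases "z = par x")
    case False
    then have "par x \<sqsubseteq> z"
      using less.hyps[of "par x"] N_par[OF less.prems] par_gt[OF x(1)] x(2) by simp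
    then show ?thesis using anc_par[OF x(1)] anc_trans by blast
  qed (use anc_par[OF x(1)] in simp)
qed

text \<open>
  Going from a vertex to its parent loses no later neighbour except the parent itself, since
  \<open>N x\<close> is a clique that contains the parent.
\<close>

lemma N_up: "x \<sqsubseteq> y \<Longrightarrow> z \<in> N x \<Longrightarrow> y < z \<Longrightarrow> z \<in> N y"
  unfolding anc_def
proof (induction rule: rtrancl_induct)
  case (step y w)
  then have "y < w" using par_gt by auto
  with step have "z \<in> N y" "z \<noteq> par y" "w = par y" by auto
  then show ?case using N_par by simp
qed

lemma anc_less: "x \<sqsubseteq> y \<Longrightarrow> y < n \<Longrightarrow> x < n"
  using anc_le by fastforce

text \<open>The bags of the tree decomposition that belongs to the elimination order. They are cliques.\<close>

definition bag :: "nat \<Rightarrow> nat set" where "bag x = insert x (N x)"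

lemma bag_clique: "y \<in> bag x \<Longrightarrow> z \<in> bag x \<Longrightarrow> y \<noteq> z \<Longrightarrow> z \<in> N y \<or> y \<in> N z"
  unfolding bag_def using clique by (metis insert_iff nat_neq_iff)

text \<open>
  The vertices from \<open>R\<close> on form a clique, so they can be visited in any order and only the
  vertices below \<open>R\<close> need planning. By minimality no longer final part of the order is a
  clique (\<open>not_R\<close>); this is used when pieces of a cut are counted.
\<close>

definition R :: nat where "R = (LEAST r. N r = {r<..<n})"

lemma N_R: "N R = {R<..<n}" and R_less: "R < n"
proof -
  have *: "N (n - 1) = {n - 1<..<n}" using later[of _ "n - 1"] by auto
  show "N R = {R<..<n}" unfolding R_def by (rule LeastI, rule *)
  have "R \<le> n - 1" unfolding R_def by (rule Least_le, rule *)
  then show "R < n" using pos by linarith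
qed

lemma not_R: "r < R \<Longrightarrow> N r \<noteq> {r<..<n}"
  unfolding R_def by (rule not_less_Least)

lemma bag_R: "bag R = {R..<n}"
  using N_R R_less by (auto simp: bag_def)

definition ch :: "nat \<Rightarrow> nat set" where "ch x = {c. c < R \<and> par c = x}"

lemma lt_R: "c < R \<Longrightarrow> Suc c < n"
  using R_less by linarith

lemma ch_lt: "c \<in> ch x \<Longrightarrow> c < x"
  using par_gt lt_R by (auto simp: ch_def)

lemma ch_anc: "c \<in> ch x \<Longrightarrow> c \<sqsubseteq> x"
  using anc_par lt_R by (auto simp: ch_def)

lemma finite_ch [simp]: "finite (ch x)"
  by (rule finite_subset[of _ "{..<R}"]) (auto simp: ch_def)

lemma anc_ch:
  assumes "d \<sqsubseteq> x" "d \<noteq> x" "x \<le> R" shows "\<exists>c\<in>ch x. d \<sqsubseteq> c"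
proof -
  obtain c where "Suc c < n" "par c = x" "d \<sqsubseteq> c" using assms(1,2) by (rule anc_child)
  then show ?thesis using par_gt[of c] assms(3) by (intro bexI[of _ c]) (auto simp: ch_def)
qed

lemma ch_not_anc: "c \<in> ch x \<Longrightarrow> c' \<in> ch x \<Longrightarrow> c \<sqsubseteq> c' \<Longrightarrow> c = c'"
proof (rule ccontr)
  assume *: "c \<in> ch x" "c' \<in> ch x" "c \<sqsubseteq> c'" "c \<noteq> c'"
  from *(3) show False
  proof (cases rule: anc_cases)
    case 2
    then have "x \<le> c'" using anc_le[of "par c" c'] *(1) by (simp add: ch_def)
    then show ?thesis using ch_lt[OF *(2)] by simp
  qed (use * in simp)
qed

lemma ch_disjoint:
  assumes "c \<in> ch x" "c' \<in> ch x" "d \<sqsubseteq> c" "d \<sqsubseteq> c'" shows "c = c'"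
  using anc_linear[OF assms(3,4)] ch_not_anc[of c x c'] ch_not_anc[of c' x c] assms(1,2) by auto

end

section \<open>Greedy plans\<close>

text \<open>
  The matched objects \<open>B\<close> are sent to slots; \<open>D s\<close> holds the objects that slot \<open>s\<close> admits. All
  of \<open>B\<close> is matched, while slots may stay empty.
\<close>

definition matching :: "('s \<Rightarrow> 'a set) \<Rightarrow> 's set \<Rightarrow> 'a set \<Rightarrow> ('a \<Rightarrow> 's) \<Rightarrow> bool" where
  "matching D Sl B M \<longleftrightarrow> inj_on M B \<and> (\<forall>b\<in>B. M b \<in> Sl \<and> b \<in> D (M b))"

lemma matching_mono: "matching D Sl B M \<Longrightarrow> B' \<subseteq> B \<Longrightarrow> Sl \<subseteq> Sl' \<Longrightarrow> matching D Sl' B' M"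
  unfolding matching_def using inj_on_subset by blast

lemma matching_cong:
  "(\<And>s. s \<in> Sl \<Longrightarrow> D s = D' s) \<Longrightarrow> matching D Sl B M \<longleftrightarrow> matching D' Sl B M"
  unfolding matching_def by blast

locale two_ends = elimination_order +
  fixes v :: nat
  assumes v: "Suc v < n"
begin

text \<open>
  The vertices that may fill slot \<open>(c, i)\<close>: they continue the open end \<open>i\<close> of the segment at
  \<open>c\<close> and lie strictly above \<open>c\<close>, which is to say at or above its parent. The two prescribed
  ends \<open>v\<close> and \<open>n - 1\<close> have their places in the path already.
\<close>

definition cand :: "(nat \<Rightarrow> bool \<Rightarrow> nat) \<Rightarrow> nat \<times> bool \<Rightarrow> nat set" where
  "cand g s = {w \<in> N (g (fst s) (snd s)). par (fst s) \<le> w} - {v, n - 1}"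

text \<open>
  A segment that contains the start \<open>v\<close> has \<open>v\<close> as one end, so that only its end \<open>True\<close> is
  open. Slots arise where a segment meets a parent that is not passing; the parents below \<open>k\<close>
  have been dealt with.
\<close>

definition slots :: "nat set \<Rightarrow> nat \<Rightarrow> (nat \<times> bool) set" where
  "slots P k = {(c, i). c < R \<and> par c < k \<and> par c \<notin> P \<and> (i \<or> \<not> v \<sqsubseteq> c)}"

definition matchable :: "(nat \<Rightarrow> bool \<Rightarrow> nat) \<Rightarrow> nat set \<Rightarrow> nat \<Rightarrow> nat set \<Rightarrow> bool" where
  "matchable g P k B \<longleftrightarrow> (\<exists>M. matching (cand g) (slots P k) B M)"

text \<open>
  How a node \<open>x\<close> extends the segment of its only child \<open>c\<close>. An accepted vertex sits in a slot
  further down and leaves the open ends as they are. Any other \<open>x\<close> is appended, by preference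
  to the end \<open>False\<close> (if it is open), whose position is the lower one. The end at \<open>x\<close> then
  becomes the end \<open>True\<close>, and the untouched end becomes the end \<open>False\<close>. This exchange is what
  keeps the number of rejected vertices that an open end leaves behind at zero for \<open>True\<close> and
  at one for \<open>False\<close> (\<open>short_upper\<close>, \<open>short_lower\<close>).
\<close>

definition passes :: "nat set \<Rightarrow> (nat \<Rightarrow> bool \<Rightarrow> nat) \<Rightarrow> (nat \<Rightarrow> nat) \<Rightarrow> nat \<Rightarrow> nat \<Rightarrow> bool" where
  "passes A g bs x c \<longleftrightarrow> ch x = {c} \<and> bs x = bs c \<and>
     (if x \<in> A then g x = g c
      else x \<in> N (g c True) \<and> g x True = x \<and>
           g x False = (if \<not> v \<sqsubseteq> c \<and> x \<in> N (g c False) then g c True else g c False))"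

lemma passes_cong:
  assumes "passes A g bs x c" "x \<in> A \<longleftrightarrow> x \<in> A'" "g' x = g x" "g' c = g c" "bs' x = bs x" "bs' c = bs c"
  shows "passes A' g' bs' x c"
  using assms by (simp add: passes_def)

end

text \<open>
  The state of the construction when the vertices below \<open>k\<close> have been treated: \<open>A\<close> holds the
  accepted vertices, \<open>P\<close> the passing nodes, \<open>g x i\<close> is the position of the open end \<open>i\<close> of the
  segment at \<open>x\<close>, and \<open>bs x\<close> is the lowest node of the run of passing nodes that ends in \<open>x\<close>.
  Nodes outside \<open>P\<close> start a new run. By \<open>event1\<close> a node with one child does so only if it
  cannot be appended or if it is \<open>v\<close>.
\<close>

locale plan = two_ends +
  fixes k :: nat and A P :: "nat set" and g :: "nat \<Rightarrow> bool \<Rightarrow> nat" and bs :: "nat \<Rightarrow> nat"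
  assumes A_sub: "A \<subseteq> {..<k}" and P_sub: "P \<subseteq> {..<k} \<inter> {..<R}" and v_P: "v \<notin> P"
    and pass: "x \<in> P \<Longrightarrow> \<exists>c. passes A g bs x c"
    and event: "x < k \<Longrightarrow> x < R \<Longrightarrow> x \<notin> P \<Longrightarrow> bs x = x \<and> g x i = x"
    and event1: "x < k \<Longrightarrow> x < R \<Longrightarrow> x \<notin> P \<Longrightarrow> x \<noteq> v \<Longrightarrow> ch x = {c} \<Longrightarrow> x \<notin> N (g c True)"
    and matchable_A: "matchable g P k A"
    and greedy: "w < k \<Longrightarrow> w \<notin> A \<Longrightarrow> \<not> matchable g P k (insert w {a \<in> A. a < w})"

context two_ends
begin

text \<open>
  Vertex \<open>k\<close> is accepted when a matching allows it. It passes when it has one child, differs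
  from \<open>v\<close>, and can be appended or matched without new slots. The decisions on earlier
  vertices stay correct: the slots that arise at \<open>k\<close> admit no vertex before \<open>k\<close>, and all older
  slots keep their candidates.
\<close>

lemma plan_exists: "k \<le> n \<Longrightarrow> \<exists>A P g bs. plan n N v k A P g bs"
proof (induction k)
  case 0
  have "plan n N v 0 {} {} (\<lambda>_ _. 0) (\<lambda>_. 0)"
    by unfold_locales (auto simp: matchable_def matching_def)
  then show ?case by blast
next
  case (Suc k)
  then obtain A P g bs where "plan n N v k A P g bs" by auto
  then interpret plan n N v k A P g bs .
  have lt: "fst s \<noteq> k" if "s \<in> slots Q k" for s Q
    using that par_gt lt_R by (fastforce simp: slots_def)
  have cand_eq: "cand (g(k := h)) s = cand g s" if "s \<in> slots Q k" for s h Q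
    using lt[OF that] by (simp add: cand_def)
  have ch_k: "c < x" "c \<noteq> k" if "ch x = {c}" "x \<le> k" for c x
    using ch_lt[of c x] that by auto
  have AB: "{a \<in> insert k A. a < w} = {a \<in> A. a < w}" if "w \<le> k" for w
    using that by auto
  have A_all: "{a \<in> A. a < k} = A" using A_sub by auto
  consider (pass) c where "k < R" "k \<noteq> v" "ch k = {c}" "matchable g P k (insert k A) \<or> k \<in> N (g c True)"
    | (event) "\<And>c. k < R \<Longrightarrow> k \<noteq> v \<Longrightarrow> ch k = {c} \<Longrightarrow> k \<notin> N (g c True)"
    by blast
  then show ?case
  proof cases
    case pass
    define A' where "A' = (if matchable g P k (insert k A) then insert k A else A)"
    define g' where "g' = g(k := if matchable g P k (insert k A) then g c else (\<lambda>i. if i then k else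
       if \<not> v \<sqsubseteq> c \<and> k \<in> N (g c False) then g c True else g c False))"
    define bs' where "bs' = bs(k := bs c)"
    have slots_eq: "slots (insert k P) (Suc k) = slots P k"
      by (auto simp: slots_def)
    have m_eq: "matchable g' (insert k P) (Suc k) B \<longleftrightarrow> matchable g P k B" for B
      unfolding matchable_def slots_eq g'_def using matching_cong[of "slots P k"] cand_eq by metis
    have old: "g' x = g x" "bs' x = bs x" "x \<in> A' \<longleftrightarrow> x \<in> A" if "x \<noteq> k" for x
      using that by (auto simp: g'_def bs'_def A'_def)
    have "plan n N v (Suc k) A' (insert k P) g' bs'"
    proof unfold_locales
      show "A' \<subseteq> {..<Suc k}" using A_sub by (auto simp: A'_def)
      show "insert k P \<subseteq> {..<Suc k} \<inter> {..<R}" using P_sub pass by auto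
      show "v \<notin> insert k P" using v_P pass by auto
      show "\<exists>c'. passes A' g' bs' x c'" if x: "x \<in> insert k P" for x
      proof (cases "x = k")
        case True
        have "c \<noteq> k" using ch_k[OF pass(3)] by simp
        moreover have "k \<notin> A" using A_sub by auto
        ultimately have "passes A' g' bs' k c"
          using pass by (auto simp: passes_def A'_def g'_def bs'_def)
        then show ?thesis using True by blast
      next
        case False
        with x have "x \<in> P" "x < k" using P_sub by auto
        obtain c' where c': "passes A g bs x c'"
          using plan.pass[OF plan_axioms \<open>x \<in> P\<close>] by blast
        then have "ch x = {c'}" by (simp add: passes_def)
        then have "c' \<noteq> k" using ch_k[of x c'] \<open>x < k\<close> by simp
        with old[of x] old[of c'] False have "passes A' g' bs' x c'"
          by (intro passes_cong[OF c']) simp_all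
        then show ?thesis by blast
      qed
      show "bs' x = x \<and> g' x i = x" if "x < Suc k" "x < R" "x \<notin> insert k P" for x i
        using that event[of x i] old by auto
      show "x \<notin> N (g' c' True)"
        if "x < Suc k" "x < R" "x \<notin> insert k P" "x \<noteq> v" "ch x = {c'}" for x c'
      proof -
        have "x < k" using that by auto
        then show ?thesis using that event1[of x c'] ch_k[OF that(5)] old by auto
      qed
      show "matchable g' (insert k P) (Suc k) A'"
        unfolding m_eq using matchable_A by (simp add: A'_def)
      show "\<not> matchable g' (insert k P) (Suc k) (insert w {a \<in> A'. a < w})"
        if "w < Suc k" "w \<notin> A'" for w
      proof (cases "w = k")
        case True
        then have "{a \<in> A'. a < w} = A" using A_all AB[of k] by (auto simp: A'_def)
        then show ?thesis unfolding m_eq using that True by (auto simp: A'_def split: if_splits)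
      next
        case False
        then have "w < k" "w \<notin> A" "{a \<in> A'. a < w} = {a \<in> A. a < w}"
          using that AB[of w] by (auto simp: A'_def split: if_splits)
        then show ?thesis unfolding m_eq using greedy by simp
      qed
    qed
    then show ?thesis by blast
  next
    case event
    let ?g = "g(k := \<lambda>_. k)"
    let ?acc = "matchable ?g P (Suc k) (insert k A)"
    have kP: "k \<notin> P" using P_sub by auto
    have sub: "slots P k \<subseteq> slots P (Suc k)" by (auto simp: slots_def)
    have m_mono: "matchable ?g P (Suc k) B" if m: "matchable g P k B" for B
    proof -
      obtain M where "matching (cand g) (slots P k) B M" using m by (auto simp: matchable_def)
      then have "matching (cand ?g) (slots P k) B M"
        using matching_cong[of "slots P k" "cand g" "cand ?g"] cand_eq by metis
      then show ?thesis unfolding matchable_def using matching_mono[OF _ order_refl sub] by blast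
    qed
    have m_back: "matchable g P k B" if m: "matchable ?g P (Suc k) B" and B: "B \<subseteq> {..<k}" for B
    proof -
      obtain M where M: "matching (cand ?g) (slots P (Suc k)) B M"
        using m by (auto simp: matchable_def)
      have "M b \<in> slots P k" if "b \<in> B" for b
        using that M B by (fastforce simp: matching_def slots_def cand_def)
      then have "matching (cand ?g) (slots P k) B M"
        using M by (auto simp: matching_def)
      then have "matching (cand g) (slots P k) B M"
        using matching_cong[of "slots P k" "cand g" "cand ?g"] cand_eq by metis
      then show ?thesis by (auto simp: matchable_def)
    qed
    define A' where "A' = (if ?acc then insert k A else A)"
    define bs' where "bs' = bs(k := k)"
    have old: "bs' x = bs x" "?g x = g x" "x \<in> A' \<longleftrightarrow> x \<in> A" if "x \<noteq> k" for x
      using that by (auto simp: bs'_def A'_def)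
    have "plan n N v (Suc k) A' P ?g bs'"
    proof unfold_locales
      show "A' \<subseteq> {..<Suc k}" using A_sub by (auto simp: A'_def)
      show "P \<subseteq> {..<Suc k} \<inter> {..<R}" using P_sub by auto
      show "v \<notin> P" by (rule v_P)
      show "\<exists>c'. passes A' ?g bs' x c'" if x: "x \<in> P" for x
      proof -
        have xk: "x < k" using x P_sub by auto
        obtain c' where c': "passes A g bs x c'"
          using plan.pass[OF plan_axioms x] by blast
        then have "ch x = {c'}" by (simp add: passes_def)
        then have "c' \<noteq> k" using ch_k[of x c'] xk by simp
        with old[of x] old[of c'] xk have "passes A' ?g bs' x c'"
          by (intro passes_cong[OF c']) simp_all
        then show ?thesis by blast
      qed
      show "bs' x = x \<and> ?g x i = x" if "x < Suc k" "x < R" "x \<notin> P" for x i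
        using that plan.event[OF plan_axioms, of x i] by (auto simp: bs'_def)
      show "x \<notin> N (?g c' True)" if "x < Suc k" "x < R" "x \<notin> P" "x \<noteq> v" "ch x = {c'}" for x c'
      proof -
        have "c' \<noteq> k" using ch_k[OF that(5)] that(1) by simp
        then show ?thesis using that event[of c'] event1[of x c'] by (cases "x = k") auto
      qed
      show "matchable ?g P (Suc k) A'" using m_mono[OF matchable_A] by (simp add: A'_def)
      show "\<not> matchable ?g P (Suc k) (insert w {a \<in> A'. a < w})"
        if "w < Suc k" "w \<notin> A'" for w
      proof (cases "w = k")
        case True
        then have "{a \<in> A'. a < w} = A" using A_all AB[of k] by (auto simp: A'_def)
        then show ?thesis using that True by (auto simp: A'_def split: if_splits)
      next
        case False
        then have w: "w < k" "w \<notin> A" "{a \<in> A'. a < w} = {a \<in> A. a < w}"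
          using that AB[of w] by (auto simp: A'_def split: if_splits)
        moreover have "insert w {a \<in> A. a < w} \<subseteq> {..<k}" using A_sub w(1) by auto
        ultimately show ?thesis using greedy m_back[of "insert w {a \<in> A. a < w}"] by auto
      qed
    qed
    then show ?thesis by blast
  qed
qed

end

section \<open>Gaps\<close>

locale full_plan = plan n N v n A P g bs for n N v A P g bs
begin

abbreviation Sl :: "(nat \<times> bool) set" where "Sl \<equiv> slots P n"

lemma Sl_iff: "(c, i) \<in> Sl \<longleftrightarrow> c < R \<and> par c \<notin> P \<and> (i \<or> \<not> v \<sqsubseteq> c)"
  using par_lt lt_R by (auto simp: slots_def)

lemma v_lt: "v < n" and v_neq: "v \<noteq> n - 1"
  using v by auto

lemma event': "x < R \<Longrightarrow> x \<notin> P \<Longrightarrow> bs x = x" "x < R \<Longrightarrow> x \<notin> P \<Longrightarrow> g x i = x"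
  using event[of x i] R_less by auto

lemma P_R: "x \<in> P \<Longrightarrow> x < R"
  using P_sub by auto

lemma passE:
  assumes "x \<in> P"
  obtains c where "ch x = {c}" "c \<in> ch x" "c < R" "c < x" "c \<sqsubseteq> x" "bs x = bs c" "passes A g bs x c" "x \<noteq> v"
proof -
  obtain c where c: "passes A g bs x c" using pass[OF assms] by blast
  then have "ch x = {c}" "bs x = bs c" by (auto simp: passes_def)
  moreover from this have cx: "c \<in> ch x" by simp
  moreover have "c < x" "c \<sqsubseteq> x" "c < R" using ch_lt[OF cx] ch_anc[OF cx] cx by (auto simp: ch_def)
  moreover have "x \<noteq> v" using assms v_P by auto
  ultimately show ?thesis using that c by blast
qed

text \<open>
  A gap is a maximal run of passing nodes together with the node below it. A vertex \<open>c < R\<close> is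
  the upper end of a gap iff its parent is not passing, and \<open>bs c\<close> is the lower end. Both open
  ends have their positions in the gap, \<open>False\<close> below \<open>True\<close>.
\<close>

lemma gap_order: "x < R \<Longrightarrow> bs x \<sqsubseteq> g x False \<and> g x False \<sqsubseteq> g x True \<and> g x True \<sqsubseteq> x \<and> bs x \<notin> P"
proof (induction x rule: less_induct)
  case (less x)
  show ?case
  proof (cases "x \<in> P")
    case True
    then obtain c where c: "c < x" "c < R" "c \<sqsubseteq> x" "bs x = bs c" "passes A g bs x c" by (rule passE)
    have IH: "bs c \<sqsubseteq> g c False" "g c False \<sqsubseteq> g c True" "g c True \<sqsubseteq> c" "bs c \<notin> P"
      using less.IH c by auto
    show ?thesis using c IH anc_trans[of "g c True" c x] anc_trans[of "g c False" "g c True" x]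
        anc_trans[of "bs c" "g c False" "g c True"]
      by (auto simp: passes_def split: if_splits)
  qed (use event' less.prems in auto)
qed

lemma g_anc: "x < R \<Longrightarrow> g x i \<sqsubseteq> x"
  using gap_order[of x] anc_trans[of "g x False" "g x True" x] by (cases i) auto

lemma bs_g: "x < R \<Longrightarrow> bs x \<sqsubseteq> g x i"
  using gap_order[of x] anc_trans[of "bs x" "g x False" "g x True"] by (cases i) auto

lemma bs_anc: "x < R \<Longrightarrow> bs x \<sqsubseteq> x"
  by (rule anc_trans[OF bs_g[of x True] g_anc[of x True]])

lemma bs_R: "x < R \<Longrightarrow> bs x < R"
  using anc_le[OF bs_anc[of x]] by simp

lemma only_child:
  assumes "ch x = {c}" "x \<le> R" "y \<sqsubseteq> x" "y \<noteq> x" shows "y \<sqsubseteq> c"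
  using anc_ch[OF assms(3,4,2)] assms(1) by auto

lemma bs_between: "x < R \<Longrightarrow> bs x \<sqsubseteq> y \<Longrightarrow> y \<sqsubseteq> x \<Longrightarrow> bs y = bs x \<and> (y \<noteq> bs x \<longrightarrow> y \<in> P)"
proof (induction x rule: less_induct)
  case (less x)
  show ?case
  proof (cases "x \<in> P")
    case True
    then obtain c where c: "ch x = {c}" "c < x" "c < R" "bs x = bs c" by (rule passE)
    show ?thesis
    proof (cases "y = x")
      case False
      then have "y \<sqsubseteq> c" using only_child[OF c(1)] less.prems by auto
      then show ?thesis using less.IH[of c] c less.prems by auto
    qed (use True in auto)
  next
    case False
    then have "y = x" using less.prems event' anc_antisym by auto
    then show ?thesis using event'[OF less.prems(1) False] by simp
  qed
qed

text \<open>
  Passing nodes have one child, so a path that enters the gap of \<open>x\<close> from below enters it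
  through \<open>bs x\<close>.
\<close>

lemma below_gap: "x < R \<Longrightarrow> d \<sqsubseteq> x \<Longrightarrow> d \<sqsubseteq> bs x \<or> (d \<in> P \<and> bs d = bs x)"
proof -
  assume *: "x < R" "d \<sqsubseteq> x"
  show ?thesis
  proof (cases "d \<sqsubseteq> bs x")
    case False
    have "x < R \<Longrightarrow> d \<sqsubseteq> x \<Longrightarrow> d \<sqsubseteq> bs x \<or> bs x \<sqsubseteq> d"
    proof (induction x rule: less_induct)
      case (less x)
      show ?case
      proof (cases "x \<in> P")
        case True
        then obtain c where c: "ch x = {c}" "c < x" "c < R" "bs x = bs c" by (rule passE)
        show ?thesis
        proof (cases "d = x")
          case True
          then show ?thesis using bs_anc less.prems by auto
        next
          case False
          then have "d \<sqsubseteq> c" using only_child[OF c(1)] less.prems by auto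
          then show ?thesis using less.IH[of c] c by auto
        qed
      qed (use less.prems event' in auto)
    qed
    then have "bs x \<sqsubseteq> d" using * False by auto
    then show ?thesis using bs_between[OF *(1) _ *(2)] False by auto
  qed auto
qed

lemma up_to_child:
  assumes "ch x = {c}" "x \<le> R" "d \<sqsubseteq> c" "d \<sqsubseteq> w" "w \<le> x" "w \<noteq> x" shows "w \<le> c"
proof -
  have "c \<in> ch x" using assms(1) by simp
  then have "d \<sqsubseteq> x" using anc_trans[OF assms(3) ch_anc] by simp
  then have "w \<sqsubseteq> x" by (rule anc_if_le[OF assms(4) _ assms(5)])
  then show ?thesis using anc_le[OF only_child[OF assms(1,2)]] assms(6) by simp
qed

text \<open>
  A rejected node of the run is appended to the segment and becomes the position of the end
  \<open>True\<close>. So the nodes that this end has left behind are accepted ones.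
\<close>

lemma short_upper: "x < R \<Longrightarrow> w \<in> N (g x True) \<Longrightarrow> w \<le> x \<Longrightarrow> w \<in> A"
proof (induction x rule: less_induct)
  case (less x)
  show ?case
  proof (cases "x \<in> P")
    case True
    then obtain c where c: "ch x = {c}" "c < x" "c < R" "passes A g bs x c" by (rule passE)
    show ?thesis
    proof (cases "x \<in> A")
      case True
      then have "g x = g c" using c by (simp add: passes_def)
      moreover have "w = x \<or> w \<le> c"
        using up_to_child[OF c(1) _ g_anc[OF c(3), of True] N_anc] less.prems calculation by auto
      ultimately show ?thesis using less.IH[OF c(2,3)] less.prems True by auto
    next
      case False
      then have "g x True = x" using c by (simp add: passes_def)
      then show ?thesis using less.prems later by fastforce
    qed
  next
    case False
    then show ?thesis using less.prems event' later by fastforce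
  qed
qed

text \<open>
  If a rejected \<open>x\<close> continues the end \<open>False\<close>, the two ends change roles there; the new end
  \<open>False\<close> is the former end \<open>True\<close>, which has left behind accepted nodes only. The one
  exception is \<open>x\<close> itself.
\<close>

lemma short_lower:
  "x < R \<Longrightarrow> \<not> v \<sqsubseteq> x \<Longrightarrow> \<exists>e. \<forall>w\<in>N (g x False). w \<le> x \<longrightarrow> w \<in> A \<or> w = e"
proof (induction x rule: less_induct)
  case (less x)
  show ?case
  proof (cases "x \<in> P")
    case True
    then obtain c where c: "ch x = {c}" "c < x" "c < R" "c \<sqsubseteq> x" "passes A g bs x c" by (rule passE)
    have nv: "\<not> v \<sqsubseteq> c" using less.prems c(4) anc_trans[of v c x] by auto
    have split: "w = x \<or> w \<le> c" if "w \<in> N (g c i)" "w \<le> x" for w i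
      using up_to_child[OF c(1) _ g_anc[OF c(3), of i] N_anc] less.prems that by auto
    obtain e where e: "\<forall>w\<in>N (g c False). w \<le> c \<longrightarrow> w \<in> A \<or> w = e"
      using less.IH[OF c(2,3) nv] by blast
    show ?thesis
    proof (cases "x \<in> A")
      case True
      then have "g x = g c" using c by (simp add: passes_def)
      then show ?thesis using e split True by metis
    next
      case xA: False
      show ?thesis
      proof (cases "x \<in> N (g c False)")
        case True
        then have "g x False = g c True" using c(5) nv xA by (simp add: passes_def)
        then show ?thesis using split short_upper[OF c(3)] by metis
      next
        case False
        then have "g x False = g c False" using c(5) nv xA by (simp add: passes_def)
        then show ?thesis using e split False by metis
      qed
    qed
  next
    case False
    then have "g x False = x" using less.prems event' by auto
    then show ?thesis using later by fastforce
  qed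
qed

lemma cand_iff:
  assumes "c < R" shows "w \<in> cand g (c, i) \<longleftrightarrow> w \<in> N (g c i) \<and> c < w \<and> w \<noteq> v \<and> w \<noteq> n - 1"
proof -
  have "c < w \<longleftrightarrow> par c \<le> w" if "w \<in> N (g c i)"
  proof
    assume "c < w"
    then have "c \<sqsubseteq> w" using anc_if_le[OF g_anc[OF assms] N_anc[OF that]] by simp
    then show "par c \<le> w" using \<open>c < w\<close> by (cases rule: anc_cases) (use anc_le in auto)
  qed (use par_gt[OF lt_R[OF assms]] in auto)
  then show ?thesis by (auto simp: cand_def)
qed

text \<open>
  This is why segments can be concatenated at the parent of \<open>c\<close>: whatever fills the slots
  there belongs to the clique \<open>bag (par c)\<close>.
\<close>

lemma cand_bag: "c < R \<Longrightarrow> cand g (c, i) \<subseteq> bag (par c)"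
proof
  fix w assume c: "c < R" and w: "w \<in> cand g (c, i)"
  then have "w \<in> N (g c i)" "par c \<le> w" by (auto simp: cand_def)
  moreover have "g c i \<sqsubseteq> par c" by (rule anc_trans[OF g_anc[OF c] anc_par[OF lt_R[OF c]]])
  ultimately show "w \<in> bag (par c)"
    using N_up[of "g c i" "par c" w] by (cases "w = par c") (auto simp: bag_def)
qed

lemma A_cand: "a \<in> A \<Longrightarrow> \<exists>c i. (c, i) \<in> Sl \<and> a \<in> cand g (c, i)"
proof -
  assume a: "a \<in> A"
  obtain M where "matching (cand g) Sl A M" using matchable_A by (auto simp: matchable_def)
  then have "M a \<in> Sl" "a \<in> cand g (M a)" using a by (auto simp: matching_def)
  then show ?thesis by (cases "M a") auto
qed

lemma v_A: "v \<notin> A" and top_A: "n - 1 \<notin> A"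
  using A_cand by (auto simp: cand_def)

section \<open>Segments\<close>

text \<open>
  The items of a segment are vertices (\<open>Inl\<close>) and slots (\<open>Inr\<close>). An item fits a bag if the bag
  is sure to contain its vertex, however the slot is filled. Two items may be consecutive if
  they fit a common bag, as bags are cliques.
\<close>

definition fits :: "nat \<Rightarrow> nat + nat \<times> bool \<Rightarrow> bool" where
  "fits y it \<longleftrightarrow> (case it of Inl w \<Rightarrow> w \<in> bag y | Inr s \<Rightarrow> cand g s \<subseteq> bag y)"

definition link :: "nat + nat \<times> bool \<Rightarrow> nat + nat \<times> bool \<Rightarrow> bool" where
  "link p q \<longleftrightarrow> (\<exists>y. fits y p \<and> fits y q)"

definition chain :: "(nat + nat \<times> bool) list \<Rightarrow> (nat + nat \<times> bool) set \<Rightarrow> bool" where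
  "chain L X \<longleftrightarrow> distinct L \<and> set L = X \<and> successively link L"

text \<open>
  What the segment at \<open>x\<close> has to visit. Accepted vertices are absent: they enter through
  slots.
\<close>

definition content :: "nat \<Rightarrow> (nat + nat \<times> bool) set" where
  "content x = Inl ` {y. y \<sqsubseteq> x \<and> y \<notin> A} \<union> Inr ` {s \<in> Sl. par (fst s) \<sqsubseteq> x}"

text \<open>The content of the segment at \<open>c\<close> after its open ends have received their slots.\<close>

definition closed_content :: "nat \<Rightarrow> (nat + nat \<times> bool) set" where
  "closed_content c = content c \<union> Inr ` {s \<in> Sl. fst s = c}"

definition segment :: "nat \<Rightarrow> (nat + nat \<times> bool) list \<Rightarrow> bool" where
  "segment x L \<longleftrightarrow> chain L (content x) \<and> L \<noteq> [] \<and> fits (g x True) (last L) \<and>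
     (if v \<sqsubseteq> x then hd L = Inl v else fits (g x False) (hd L))"

lemma linkI: "fits y p \<Longrightarrow> fits y q \<Longrightarrow> link p q"
  by (auto simp: link_def)

lemma chain_append:
  assumes "chain L X" "chain L' X'" "X \<inter> X' = {}"
    and "L \<noteq> [] \<Longrightarrow> L' \<noteq> [] \<Longrightarrow> link (last L) (hd L')"
  shows "chain (L @ L') (X \<union> X')"
  using assms by (auto simp: chain_def successively_append_iff)

lemma chain_rev: "chain L X \<Longrightarrow> chain (rev L) X"
proof -
  have "(\<lambda>x y. link y x) = link" by (intro ext) (auto simp: link_def)
  then have "successively link (rev L) = successively link L"
    by (simp only: successively_rev)
  then show "chain L X \<Longrightarrow> chain (rev L) X" by (simp add: chain_def)
qed

lemma chain_single: "chain [p] {p}"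
  by (simp add: chain_def)

lemma chain_Nil: "chain [] {}"
  by (simp add: chain_def)

lemma closed_content_anc:
  assumes "c < R" "p \<in> closed_content c" shows "(case p of Inl y \<Rightarrow> y | Inr s \<Rightarrow> fst s) \<sqsubseteq> c"
proof -
  have "d \<sqsubseteq> c" if "par d \<sqsubseteq> c" "(d, i) \<in> Sl" for d i
    using that anc_trans[OF anc_par[OF lt_R] that(1)] by (simp add: Sl_iff)
  then show ?thesis using assms by (auto simp: closed_content_def content_def)
qed

text \<open>The slot \<open>(c, i)\<close> fits the bag of \<open>g c i\<close>, because its candidates continue that end.\<close>

lemma close_segment:
  assumes c: "c < R" "par c \<notin> P" and L: "segment c L"
  shows "\<exists>L'. chain L' (closed_content c) \<and> last L' = Inr (c, True) \<and>
    hd L' = (if v \<sqsubseteq> c then Inl v else Inr (c, False)) \<and> L' \<noteq> []"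
proof -
  have new: "\<not> par c \<sqsubseteq> c" using par_gt[OF lt_R[OF c(1)]] anc_le by fastforce
  have ok: "fits (g c i) (Inr (c, i))" for i
    using cand_iff[OF c(1)] by (auto simp: fits_def bag_def)
  have ch: "chain L (content c)" "L \<noteq> []" "fits (g c True) (last L)"
    using L by (auto simp: segment_def)
  have notin: "Inr (c, i) \<notin> content c" for i using new by (auto simp: content_def)
  have 1: "chain (L @ [Inr (c, True)]) (content c \<union> {Inr (c, True)})"
    by (rule chain_append[OF ch(1) chain_single]) (use notin linkI[OF ch(3) ok] in auto)
  show ?thesis
  proof (cases "v \<sqsubseteq> c")
    case True
    then have "{s \<in> Sl. fst s = c} = {(c, True)}" using c Sl_iff by auto
    then show ?thesis using 1 ch True L
      by (intro exI[of _ "L @ [Inr (c, True)]"]) (auto simp: closed_content_def segment_def)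
  next
    case False
    then have "{s \<in> Sl. fst s = c} = {(c, True), (c, False)}" using c Sl_iff by auto
    moreover have "chain ([Inr (c, False)] @ (L @ [Inr (c, True)]))
        ({Inr (c, False)} \<union> (content c \<union> {Inr (c, True)}))"
      by (rule chain_append[OF chain_single 1])
        (use notin ch linkI[OF ok[of False], of "hd L"] False L in \<open>auto simp: segment_def\<close>)
    ultimately show ?thesis using False
      by (intro exI[of _ "[Inr (c, False)] @ (L @ [Inr (c, True)])"])
        (auto simp: closed_content_def insert_commute)
  qed
qed

lemma join_chains:
  assumes "finite C"
    and "\<And>c. c \<in> C \<Longrightarrow> \<exists>L. chain L (X c) \<and> (L \<noteq> [] \<longrightarrow> fits y (hd L) \<and> fits y (last L))"
    and "\<And>c c'. c \<in> C \<Longrightarrow> c' \<in> C \<Longrightarrow> c \<noteq> c' \<Longrightarrow> X c \<inter> X c' = {}"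
  shows "\<exists>L. chain L (\<Union>c\<in>C. X c) \<and> (L \<noteq> [] \<longrightarrow> fits y (hd L) \<and> fits y (last L))"
  using assms
proof (induction C)
  case empty
  then show ?case using chain_Nil by auto
next
  case (insert c C)
  obtain L where L: "chain L (\<Union>c\<in>C. X c)" "L \<noteq> [] \<longrightarrow> fits y (hd L) \<and> fits y (last L)"
    using insert.IH insert.prems by blast
  obtain L' where L': "chain L' (X c)" "L' \<noteq> [] \<longrightarrow> fits y (hd L') \<and> fits y (last L')"
    using insert.prems(1)[of c] by blast
  have "X c \<inter> (\<Union>c\<in>C. X c) = {}" using insert.prems(2) insert.hyps(2) by blast
  then have "chain (L' @ L) (X c \<union> (\<Union>c\<in>C. X c))"
    by (rule chain_append[OF L'(1) L(1)]) (use L L' linkI in auto)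
  then show ?case using L L' by (intro exI[of _ "L' @ L"]) (auto simp: hd_append last_append)
qed

text \<open>
  Closed segments whose slots fit a common bag \<open>y\<close> are concatenated in any order, except that
  the one that contains \<open>v\<close> comes first.
\<close>

lemma gather:
  assumes C: "finite C" "\<And>c. c \<in> C \<Longrightarrow> c < R \<and> par c \<notin> P \<and> (\<exists>L. segment c L)"
    and disj: "\<And>c c' d. c \<in> C \<Longrightarrow> c' \<in> C \<Longrightarrow> d \<sqsubseteq> c \<Longrightarrow> d \<sqsubseteq> c' \<Longrightarrow> c = c'"
    and y: "\<And>c i. c \<in> C \<Longrightarrow> cand g (c, i) \<subseteq> bag y"
  shows "\<exists>L. chain L (\<Union>c\<in>C. closed_content c) \<and> (L \<noteq> [] \<longrightarrow> fits y (last L)) \<and>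
    (if \<exists>c\<in>C. v \<sqsubseteq> c then L \<noteq> [] \<and> hd L = Inl v else L \<noteq> [] \<longrightarrow> fits y (hd L))"
proof -
  have ok: "fits y (Inr (c, i))" if "c \<in> C" for c i
    using y[OF that] by (auto simp: fits_def)
  have disj': "closed_content c \<inter> closed_content c' = {}" if "c \<in> C" "c' \<in> C" "c \<noteq> c'" for c c'
    using closed_content_anc[of c] closed_content_anc[of c'] C(2) disj that by blast
  have ex: "\<exists>L. chain L (closed_content c) \<and> last L = Inr (c, True) \<and>
      hd L = (if v \<sqsubseteq> c then Inl v else Inr (c, False)) \<and> L \<noteq> []" if "c \<in> C" for c
    using C(2)[OF that] close_segment by blast
  let ?C = "{c \<in> C. \<not> v \<sqsubseteq> c}"
  have "\<exists>L. chain L (\<Union>c\<in>?C. closed_content c) \<and> (L \<noteq> [] \<longrightarrow> fits y (hd L) \<and> fits y (last L))"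
  proof (rule join_chains)
    fix c assume "c \<in> ?C"
    then have c: "c \<in> C" "\<not> v \<sqsubseteq> c" by auto
    then show "\<exists>L. chain L (closed_content c) \<and> (L \<noteq> [] \<longrightarrow> fits y (hd L) \<and> fits y (last L))"
      using ex[OF c(1)] ok[OF c(1)] by auto
  qed (use C(1) disj' in auto)
  then obtain L where L: "chain L (\<Union>c\<in>?C. closed_content c)"
    "L \<noteq> [] \<longrightarrow> fits y (hd L) \<and> fits y (last L)" by blast
  show ?thesis
  proof (cases "\<exists>c\<in>C. v \<sqsubseteq> c")
    case False
    then have "?C = C" by auto
    then show ?thesis using L False by auto
  next
    case True
    then obtain c where c: "c \<in> C" "v \<sqsubseteq> c" by auto
    then have Un: "(\<Union>c\<in>C. closed_content c) = closed_content c \<union> (\<Union>c\<in>?C. closed_content c)"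
      using disj by blast
    obtain L' where L': "chain L' (closed_content c)" "last L' = Inr (c, True)" "hd L' = Inl v" "L' \<noteq> []"
      using ex[OF c(1)] c(2) by auto
    have "closed_content c \<inter> (\<Union>c\<in>?C. closed_content c) = {}" using disj' c by blast
    then have "chain (L' @ L) (\<Union>c\<in>C. closed_content c)"
      unfolding Un by (rule chain_append[OF L'(1) L(1)]) (use L L' ok[OF c(1)] linkI in auto)
    then show ?thesis using L L' True ok[OF c(1)] by (intro exI[of _ "L' @ L"]) (auto simp: last_append)
  qed
qed

lemma content_event:
  assumes "x < R" "x \<notin> P"
  shows "content x = (\<Union>c\<in>ch x. closed_content c) \<union> (if x \<in> A then {} else {Inl x})" (is "_ = ?U \<union> ?X")
proof
  have anc: "y \<sqsubseteq> x \<longleftrightarrow> y = x \<or> (\<exists>c\<in>ch x. y \<sqsubseteq> c)" for y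
  proof
    assume "y \<sqsubseteq> x"
    then show "y = x \<or> (\<exists>c\<in>ch x. y \<sqsubseteq> c)" using anc_ch[of y x] assms(1) by auto
  next
    assume "y = x \<or> (\<exists>c\<in>ch x. y \<sqsubseteq> c)"
    then show "y \<sqsubseteq> x" using anc_trans[OF _ ch_anc] by auto
  qed
  show "content x \<subseteq> ?U \<union> ?X"
  proof
    fix p assume p: "p \<in> content x"
    show "p \<in> ?U \<union> ?X"
    proof (cases p)
      case (Inl y)
      then show ?thesis using p anc[of y] by (auto simp: content_def closed_content_def)
    next
      case (Inr s)
      then have s: "s \<in> Sl" "par (fst s) \<sqsubseteq> x" using p by (auto simp: content_def)
      then have "fst s \<in> ch (par (fst s))" by (cases s) (simp add: Sl_iff ch_def)
      then show ?thesis using s anc[of "par (fst s)"] Inr by (fastforce simp: content_def closed_content_def)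
    qed
  qed
  show "?U \<union> ?X \<subseteq> content x"
  proof
    fix p assume "p \<in> ?U \<union> ?X"
    then consider "p = Inl x" "x \<notin> A" | c where "c \<in> ch x" "p \<in> content c"
      | s where "s \<in> Sl" "fst s \<in> ch x" "p = Inr s"
      by (auto simp: closed_content_def split: if_splits)
    then show "p \<in> content x"
    proof cases
      case 2
      then show ?thesis using anc_trans[OF _ ch_anc[OF 2(1)]] by (auto simp: content_def)
    qed (auto simp: content_def ch_def)
  qed
qed

lemma content_pass:
  assumes "x \<in> P" "ch x = {c}"
  shows "content x = content c \<union> (if x \<in> A then {} else {Inl x})"
proof -
  have c: "c \<in> ch x" "x < R" using assms P_R by auto
  have anc: "y \<sqsubseteq> x \<longleftrightarrow> y = x \<or> y \<sqsubseteq> c" for y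
    using only_child[OF assms(2), of y] c anc_trans[OF _ ch_anc[OF c(1)], of y] by auto
  have "s \<notin> Sl" if "par (fst s) = x" for s
    using that assms(1) by (cases s) (auto simp: Sl_iff)
  then have "{s \<in> Sl. par (fst s) \<sqsubseteq> x} = {s \<in> Sl. par (fst s) \<sqsubseteq> c}" using anc by auto
  moreover have "{y. y \<sqsubseteq> x \<and> y \<notin> A} = {y. y \<sqsubseteq> c \<and> y \<notin> A} \<union> (if x \<in> A then {} else {x})"
    using anc by auto
  ultimately show ?thesis unfolding content_def by auto
qed

text \<open>
  Induction along the tree. A passing node is appended as \<open>passes\<close> prescribes, with a reversal
  when the ends change roles. At any other node \<open>x\<close> the closed segments of the children are
  gathered in the bag of \<open>x\<close>, and \<open>x\<close> itself follows unless it is accepted; if \<open>x = v\<close>, it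
  goes first.
\<close>

lemma segment_exists: "x < R \<Longrightarrow> \<exists>L. segment x L"
proof (induction x rule: less_induct)
  case (less x)
  have self: "fits y (Inl y)" for y by (simp add: fits_def bag_def)
  show ?case
  proof (cases "x \<in> P")
    case True
    then obtain c where c: "ch x = {c}" "c \<in> ch x" "c < R" "c < x" "c \<sqsubseteq> x" "passes A g bs x c" "x \<noteq> v"
      by (rule passE)
    obtain L where L: "segment c L" using less.IH c by blast
    then have Lc: "chain L (content c)" "L \<noteq> []" "fits (g c True) (last L)"
      by (auto simp: segment_def)
    have vx: "v \<sqsubseteq> x \<longleftrightarrow> v \<sqsubseteq> c"
      using only_child[OF c(1), of v] less.prems c(7) anc_trans[OF _ c(5), of v] by auto
    have xc: "Inl x \<notin> content c" using c(4) anc_le by (fastforce simp: content_def)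
    show ?thesis
    proof (cases "x \<in> A")
      case True
      then have "g x = g c" "content x = content c"
        using c content_pass[OF \<open>x \<in> P\<close> c(1)] by (auto simp: passes_def)
      then have "segment x L" using L vx by (simp add: segment_def)
      then show ?thesis by blast
    next
      case xA: False
      then have cont: "content x = content c \<union> {Inl x}" using content_pass[OF \<open>x \<in> P\<close> c(1)] by simp
      have gx: "x \<in> N (g c True)" "g x True = x" using c xA by (auto simp: passes_def)
      show ?thesis
      proof (cases "\<not> v \<sqsubseteq> c \<and> x \<in> N (g c False)")
        case True
        then have gf: "g x False = g c True" using c(6) xA by (auto simp: passes_def)
        have "chain (rev L @ [Inl x]) (content x)" unfolding cont
        proof (rule chain_append[OF chain_rev[OF Lc(1)] chain_single])
          have "fits (g c False) (hd L)" using L True by (simp add: segment_def)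
          moreover have "fits (g c False) (Inl x)" using True by (simp add: fits_def bag_def)
          ultimately show "link (last (rev L)) (hd [Inl x])"
            using Lc(2) linkI by (simp add: last_rev)
        qed (use xc in auto)
        then have "segment x (rev L @ [Inl x])"
          using Lc gx gf True vx self by (auto simp: segment_def hd_rev)
        then show ?thesis by blast
      next
        case False
        then have gf: "g x False = g c False" using c(6) xA by (auto simp: passes_def)
        have "chain (L @ [Inl x]) (content x)" unfolding cont
        proof (rule chain_append[OF Lc(1) chain_single])
          have "fits (g c True) (Inl x)" using gx by (simp add: fits_def bag_def)
          then show "link (last L) (hd [Inl x])" using Lc(3) linkI by simp
        qed (use xc in auto)
        then have "segment x (L @ [Inl x])"
          using Lc L gx gf vx self by (auto simp: segment_def)
        then show ?thesis by blast
      qed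
    qed
  next
    case False
    have gx: "g x i = x" for i using event'[OF less.prems False] by simp
    have chd: "c < R" "par c = x" "c < x" if "c \<in> ch x" for c
      using that ch_lt[OF that] by (auto simp: ch_def)
    have "\<exists>L. chain L (\<Union>c\<in>ch x. closed_content c) \<and> (L \<noteq> [] \<longrightarrow> fits x (last L)) \<and>
      (if \<exists>c\<in>ch x. v \<sqsubseteq> c then L \<noteq> [] \<and> hd L = Inl v else L \<noteq> [] \<longrightarrow> fits x (hd L))"
    proof (rule gather)
      show "c < R \<and> par c \<notin> P \<and> (\<exists>L. segment c L)" if "c \<in> ch x" for c
        using chd[OF that] False less.IH[of c] by auto
      show "cand g (c, i) \<subseteq> bag x" if "c \<in> ch x" for c i
        using cand_bag[of c i] chd[OF that] by simp
    qed (use ch_disjoint in auto)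
    then obtain L where L: "chain L (\<Union>c\<in>ch x. closed_content c)" "L \<noteq> [] \<longrightarrow> fits x (last L)"
      "if \<exists>c\<in>ch x. v \<sqsubseteq> c then L \<noteq> [] \<and> hd L = Inl v else L \<noteq> [] \<longrightarrow> fits x (hd L)" by blast
    have xnot: "Inl x \<notin> (\<Union>c\<in>ch x. closed_content c)"
    proof
      assume "Inl x \<in> (\<Union>c\<in>ch x. closed_content c)"
      then obtain c where c: "c \<in> ch x" "Inl x \<in> closed_content c" by blast
      then have "x \<sqsubseteq> c" using closed_content_anc[of c "Inl x"] chd by auto
      then show False using anc_le[of x c] chd(3)[OF c(1)] by simp
    qed
    show ?thesis
    proof (cases "x = v")
      case True
      have "\<not> v \<sqsubseteq> c" if "c \<in> ch x" for c
        using chd(3)[OF that] anc_le[of v c] True by auto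
      then have hdL: "L \<noteq> [] \<longrightarrow> fits x (hd L)" using L(3) by auto
      have "chain ([Inl v] @ L) ({Inl v} \<union> (\<Union>c\<in>ch x. closed_content c))"
        by (rule chain_append[OF chain_single L(1)])
          (use xnot True hdL linkI[OF self[of x], of "hd L"] in auto)
      moreover have "content x = {Inl v} \<union> (\<Union>c\<in>ch x. closed_content c)"
        using content_event[OF less.prems False] True v_A by auto
      ultimately have "segment x ([Inl v] @ L)"
        using L(2) True gx self by (auto simp: segment_def last_append)
      then show ?thesis by blast
    next
      case xv: False
      let ?X = "if x \<in> A then [] else [Inl x]"
      have chain: "chain (L @ ?X) (content x)"
        unfolding content_event[OF less.prems False]
        by (rule chain_append[OF L(1)])
          (use xnot L(2) linkI[OF _ self[of x], of "last L"] chain_single chain_Nil in auto)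
      \<comment> \<open>an accepted vertex fills a slot below it, so it has children and their slots are in the list\<close>
      have ne: "L \<noteq> [] \<or> x \<notin> A"
      proof (rule ccontr)
        assume "\<not> ?thesis"
        then have *: "x \<in> A" "L = []" by auto
        then obtain c i where ci: "(c, i) \<in> Sl" "x \<in> cand g (c, i)" using A_cand by blast
        then have c: "c < R" "c < x" "x \<in> N (g c i)" using cand_iff[of c x i] Sl_iff by auto
        then have "g c i \<sqsubseteq> x" "g c i \<noteq> x" using N_anc later[OF c(3)] by auto
        then obtain d where d: "d \<in> ch x" using anc_ch less.prems by fastforce
        then have "(d, True) \<in> Sl" using chd[OF d] False Sl_iff by auto
        then have "Inr (d, True) \<in> closed_content d" by (auto simp: closed_content_def)
        then show False using L(1) d *(2) by (auto simp: chain_def)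
      qed
      have vx: "v \<sqsubseteq> x \<longleftrightarrow> (\<exists>c\<in>ch x. v \<sqsubseteq> c)"
        using anc_ch[of v x] xv less.prems anc_trans[OF _ ch_anc, of v] by auto
      have "segment x (L @ ?X)"
        using chain ne L(2,3) gx self vx by (auto simp: segment_def hd_append last_append)
      then show ?thesis by blast
    qed
  qed
qed

end

section \<open>The Hamilton path when all slots are filled\<close>

context full_plan
begin

lemma successively_all: "(\<And>p. p \<in> set L \<Longrightarrow> fits y p) \<Longrightarrow> successively link L"
  by (induction L rule: induct_list012) (auto intro: linkI)

lemma successively_neq: "distinct L \<Longrightarrow> successively link L \<Longrightarrow> successively (\<lambda>p q. link p q \<and> p \<noteq> q) L"
  by (induction L rule: induct_list012) auto

lemma below_top_gap: "y < R \<Longrightarrow> \<exists>c. c < R \<and> R \<le> par c \<and> y \<sqsubseteq> c"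
proof (induction "n - y" arbitrary: y rule: less_induct)
  case less
  show ?case
  proof (cases "R \<le> par y")
    case True
    then show ?thesis using less.prems by (intro exI[of _ y]) simp
  next
    case False
    have y: "Suc y < n" using lt_R[OF less.prems] .
    then have "n - par y < n - y" using par_gt[OF y] by simp
    then obtain c where c: "c < R" "R \<le> par c" "par y \<sqsubseteq> c" using less.hyps False by force
    then show ?thesis using anc_trans[OF anc_par[OF y] c(3)] by blast
  qed
qed

text \<open>
  The segments of the maximal subtrees below \<open>R\<close> are gathered in the clique of \<open>R\<close>, followed
  by the vertices of this clique that are left, with \<open>n - 1\<close> as the last. Replacing each slot
  by the vertex matched to it gives a path, since consecutive items fit a common clique. It
  visits all vertices, because the matching is a bijection from \<open>A\<close> to the slots.
\<close>

lemma spanning_path: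
  assumes M: "matching (cand g) Sl A M" and onto: "Sl \<subseteq> M ` A"
  shows "\<exists>p. p \<noteq> [] \<and> distinct p \<and> set p = {..<n} \<and> hd p = v \<and> last p = n - 1 \<and>
    successively (\<lambda>x y. y \<in> N x \<or> x \<in> N y) p"
proof -
  define C where "C = {c. c < R \<and> R \<le> par c}"
  define rest where "rest = sorted_list_of_set ({R..<n} - A - {v, n - 1})"
  have R_fits: "fits R (Inl y) \<longleftrightarrow> R \<le> y \<and> y < n" for y
    by (simp add: fits_def bag_R)
  have "\<exists>L. chain L (\<Union>c\<in>C. closed_content c) \<and> (L \<noteq> [] \<longrightarrow> fits R (last L)) \<and>
    (if \<exists>c\<in>C. v \<sqsubseteq> c then L \<noteq> [] \<and> hd L = Inl v else L \<noteq> [] \<longrightarrow> fits R (hd L))"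
  proof (rule gather)
    show "finite C" by (rule finite_subset[of _ "{..<R}"]) (auto simp: C_def)
    show "c < R \<and> par c \<notin> P \<and> (\<exists>L. segment c L)" if "c \<in> C" for c
      using that P_R[of "par c"] segment_exists by (auto simp: C_def)
    have *: False if cc: "c \<in> C" "c' \<in> C" "c \<sqsubseteq> c'" "c \<noteq> c'" for c c'
      using cc(3)
    proof (cases rule: anc_cases)
      case 2
      then show ?thesis using anc_le[of "par c" c'] cc by (auto simp: C_def)
    qed (use cc in simp)
    show "c = c'" if "c \<in> C" "c' \<in> C" "d \<sqsubseteq> c" "d \<sqsubseteq> c'" for c c' d
      using anc_linear[OF that(3,4)] *[of c c'] *[of c' c] that by blast
    show "cand g (c, i) \<subseteq> bag R" if "c \<in> C" for c i
      using that later by (auto simp: bag_R cand_def C_def)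
  qed
  then obtain L where L: "chain L (\<Union>c\<in>C. closed_content c)" "L \<noteq> [] \<longrightarrow> fits R (last L)"
    "if \<exists>c\<in>C. v \<sqsubseteq> c then L \<noteq> [] \<and> hd L = Inl v else L \<noteq> [] \<longrightarrow> fits R (hd L)" by blast
  have vC: "(\<exists>c\<in>C. v \<sqsubseteq> c) \<longleftrightarrow> v < R"
    using below_top_gap[of v] anc_le[of v] by (fastforce simp: C_def)
  have content: "(\<Union>c\<in>C. closed_content c) = Inl ` {y. y < R \<and> y \<notin> A} \<union> Inr ` Sl" (is "?U = ?V")
  proof
    show "?U \<subseteq> ?V"
    proof
      fix p assume "p \<in> ?U"
      then obtain c where c: "c < R" "p \<in> closed_content c" by (auto simp: C_def)
      then show "p \<in> ?V" using anc_le[of _ c] by (fastforce simp: closed_content_def content_def)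
    qed
    show "?V \<subseteq> ?U"
    proof
      fix p assume p: "p \<in> ?V"
      show "p \<in> ?U"
      proof (cases p)
        case (Inl y)
        then have "y < R" "y \<notin> A" using p by auto
        moreover obtain c where "c \<in> C" "y \<sqsubseteq> c" using below_top_gap[OF \<open>y < R\<close>] by (auto simp: C_def)
        ultimately show ?thesis using Inl by (auto simp: closed_content_def content_def)
      next
        case (Inr s)
        then have s: "s \<in> Sl" using p by auto
        then have "fst s < R" by (cases s) (simp add: Sl_iff)
        show ?thesis
        proof (cases "R \<le> par (fst s)")
          case True
          then have "fst s \<in> C" using \<open>fst s < R\<close> by (simp add: C_def)
          then show ?thesis using s Inr by (auto simp: closed_content_def)
        next
          case False
          then obtain c where "c \<in> C" "par (fst s) \<sqsubseteq> c"
            using below_top_gap[of "par (fst s)"] by (auto simp: C_def)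
          then show ?thesis using s Inr by (auto simp: closed_content_def content_def)
        qed
      qed
    qed
  qed
  have chain_rest: "chain (map Inl rest) (Inl ` ({R..<n} - A - {v, n - 1}))"
    unfolding chain_def rest_def
    by (intro conjI successively_all[of _ R]) (auto simp: distinct_map R_fits)
  have ok_rest: "fits R p" if "p \<in> set (map Inl rest)" for p
    using that by (auto simp: rest_def R_fits)
  have top: "fits R (Inl (n - 1))" using R_less by (auto simp: R_fits)
  have tail: "chain (map Inl rest @ [Inl (n - 1)]) (Inl ` ({R..<n} - A - {v, n - 1}) \<union> {Inl (n - 1)})"
  proof (rule chain_append[OF chain_rest chain_single])
    assume "map Inl rest \<noteq> ([] :: (nat + nat \<times> bool) list)"
    then show "link (last (map Inl rest)) (hd [Inl (n - 1)])"
      using linkI[OF ok_rest[OF last_in_set] top] by simp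
  qed auto
  have hd_tail: "fits R (hd (map Inl rest @ [Inl (n - 1)]))"
    using ok_rest[of "hd (map Inl rest)"] top by (cases "rest") auto
  have body: "chain (L @ (map Inl rest @ [Inl (n - 1)]))
      (?U \<union> (Inl ` ({R..<n} - A - {v, n - 1}) \<union> {Inl (n - 1)}))"
    by (rule chain_append[OF L(1) tail]) (use L(2) hd_tail linkI R_less in \<open>auto simp: content\<close>)
  \<comment> \<open>if \<open>v\<close> belongs to the clique of \<open>R\<close>, no segment starts in \<open>v\<close>, and it is put in front\<close>
  define K where "K = (if R \<le> v then [Inl v] else []) @ (L @ (map Inl rest @ [Inl (n - 1)]))"
  define I :: "(nat + nat \<times> bool) set" where "I = Inl ` ({..<n} - A) \<union> Inr ` Sl"
  have sets: "{..<n} - A = {y. y < R \<and> y \<notin> A} \<union> (({R..<n} - A - {v, n - 1}) \<union> {n - 1}) \<union> {v}"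
    using v_A top_A v_lt R_less by auto
  have K: "chain K I \<and> hd K = Inl v"
  proof (cases "R \<le> v")
    case True
    have "chain ([Inl v] @ (L @ (map Inl rest @ [Inl (n - 1)])))
      ({Inl v} \<union> (?U \<union> (Inl ` ({R..<n} - A - {v, n - 1}) \<union> {Inl (n - 1)})))"
    proof (rule chain_append[OF chain_single body])
      have "fits R (hd (L @ map Inl rest @ [Inl (n - 1)]))"
        using L(3) vC True hd_tail by (auto simp: hd_append)
      moreover have "fits R (Inl v)" using True v_lt by (simp add: R_fits)
      ultimately show "link (last [Inl v]) (hd (L @ map Inl rest @ [Inl (n - 1)]))"
        by (auto intro: linkI)
    qed (use True v_neq in \<open>auto simp: content\<close>)
    moreover have "{Inl v} \<union> (?U \<union> (Inl ` ({R..<n} - A - {v, n - 1}) \<union> {Inl (n - 1)})) = I"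
      unfolding content I_def sets by auto
    ultimately show ?thesis using True by (simp add: K_def)
  next
    case False
    then have "?U \<union> (Inl ` ({R..<n} - A - {v, n - 1}) \<union> {Inl (n - 1)}) = I"
      unfolding content I_def sets using v_A by auto
    then show ?thesis using body L(3) vC False by (auto simp: K_def hd_append)
  qed
  \<comment> \<open>the vertex that an item finally stands for\<close>
  define f where "f p = (case p of Inl w \<Rightarrow> w | Inr s \<Rightarrow> inv_into A M s)" for p :: "nat + nat \<times> bool"
  have inv: "inv_into A M s \<in> A" "M (inv_into A M s) = s" "inv_into A M s \<in> cand g s" if "s \<in> Sl" for s
    using onto that inv_into_into[of s M A] f_inv_into_f[of s M A] M by (auto simp: matching_def)
  have A_n: "A \<subseteq> {..<n}" by (rule A_sub)
  have inj: "inj_on f I"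
  proof (rule inj_onI)
    fix p q assume pq: "p \<in> I" "q \<in> I" "f p = f q"
    have Inl: "f r \<notin> A \<and> r = Inl (f r) \<or> f r \<in> A \<and> r = Inr (M (f r))" if "r \<in> I" for r
      using that inv by (cases r) (auto simp: f_def I_def)
    show "p = q" using Inl[OF pq(1)] Inl[OF pq(2)] pq(3) by auto
  qed
  have img: "f ` I = {..<n}"
  proof
    show "f ` I \<subseteq> {..<n}" using subsetD[OF A_n inv(1)] by (auto simp: f_def I_def)
    show "{..<n} \<subseteq> f ` I"
    proof
      fix y assume y: "y \<in> {..<n}"
      show "y \<in> f ` I"
      proof (cases "y \<in> A")
        case True
        then have "f (Inr (M y)) = y" "M y \<in> Sl"
          using M by (auto simp: f_def matching_def)
        then show ?thesis by (force simp: I_def)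
      next
        case False
        then have "f (Inl y) = y" "Inl y \<in> I" using y by (auto simp: f_def I_def)
        then show ?thesis by force
      qed
    qed
  qed
  have adj: "f q \<in> N (f p) \<or> f p \<in> N (f q)" if pq: "p \<in> I" "q \<in> I" "link p q \<and> p \<noteq> q" for p q
  proof -
    have bag: "f r \<in> bag y" if "r \<in> I" "fits y r" for r y
      using that inv by (cases r) (auto simp: fits_def f_def I_def)
    obtain y where "fits y p" "fits y q" using pq(3) by (auto simp: link_def)
    then show ?thesis
      using bag_clique[of "f p" y "f q"] bag[of p y] bag[of q y] pq inj_onD[OF inj, of p q] by auto
  qed
  have K': "distinct K" "set K = I" "successively (\<lambda>p q. link p q \<and> p \<noteq> q) K"
    using K successively_neq by (auto simp: chain_def)
  have "successively (\<lambda>x y. y \<in> N x \<or> x \<in> N y) (map f K)"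
    unfolding successively_map by (rule successively_mono[OF K'(3)]) (use adj K'(2) in auto)
  moreover have "distinct (map f K)" "set (map f K) = {..<n}"
    using K' inj img by (auto simp: distinct_map)
  moreover have "K \<noteq> []" by (simp add: K_def)
  moreover have "f (hd K) = v" using K by (simp add: f_def)
  moreover have "f (last K) = n - 1" by (simp add: K_def f_def)
  ultimately show ?thesis by (intro exI[of _ "map f K"]) (simp add: hd_map last_map)
qed

end

section \<open>A small cut when a slot is empty\<close>

text \<open>
  One step of an alternating path: a matched candidate of the first slot occupies the second
  slot. The candidate could move to the first slot and would free the second.
\<close>

definition alternates :: "('s \<Rightarrow> 'a set) \<Rightarrow> 'a set \<Rightarrow> ('a \<Rightarrow> 's) \<Rightarrow> ('s \<times> 's) set" where
  "alternates D B M = {(s, s'). \<exists>a\<in>B. a \<in> D s \<and> M a = s'}"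

text \<open>
  Moving one object along an alternating path that starts in the empty slot \<open>h\<close> empties the
  next slot of the path. The path is taken shortest so that the objects of its later steps are
  not the one just moved.
\<close>

lemma augment_relpow:
  assumes "matching D Sl B M" "h \<in> Sl" "h \<notin> M ` B" "(h, s) \<in> alternates D B M ^^ k" "w \<in> D s" "w \<notin> B"
  shows "\<exists>M'. matching D Sl (insert w B) M'"
  using assms
proof (induction k arbitrary: M h rule: less_induct)
  case (less k)
  show ?case
  proof (cases "\<exists>j<k. (h, s) \<in> alternates D B M ^^ j")
    case True
    then show ?thesis using less by blast
  next
    case shortest: False
    show ?thesis
    proof (cases k)
      case 0
      then have "matching D Sl (insert w B) (M(w := h))"
        using less.prems by (auto simp: matching_def inj_on_def)
      then show ?thesis by blast
    next
      case (Suc m)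
      obtain p where p: "p 0 = h" "p k = s" "\<And>i. i < k \<Longrightarrow> (p i, p (Suc i)) \<in> alternates D B M"
        using less.prems(4) by (auto simp: relpow_fun_conv)
      obtain a where a: "a \<in> B" "a \<in> D h" "M a = p 1" using p(3)[of 0] p(1) Suc by (auto simp: alternates_def)
      define M' where "M' = M(a := h)"
      have M': "matching D Sl B M'"
        using less.prems(1-3) a by (auto simp: matching_def inj_on_def M'_def)
      have p1: "p 1 \<in> Sl" using less.prems(1) a by (auto simp: matching_def)
      have p1': "p 1 \<notin> M' ` B"
      proof
        assume "p 1 \<in> M' ` B"
        then obtain b where b: "b \<in> B" "M' b = M a" using a(3) by auto
        have inj: "inj_on M B" using less.prems(1) by (simp add: matching_def)
        show False
        proof (cases "b = a")
          case True
          then have "h = M a" using b by (simp add: M'_def)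
          then show ?thesis using less.prems(3) a(1) by blast
        next
          case False
          then have "M b = M a" using b by (simp add: M'_def)
          then show ?thesis using inj_onD[OF inj] b a False by blast
        qed
      qed
      have step: "(p i, p (Suc i)) \<in> alternates D B M'" if i: "1 \<le> i" "i < k" for i
      proof -
        obtain b where b: "b \<in> B" "b \<in> D (p i)" "M b = p (Suc i)"
          using p(3)[OF i(2)] by (auto simp: alternates_def)
        have "b \<noteq> a"
        proof
          assume "b = a"
          then have eq: "p (Suc i) = p 1" using b a by simp
          have "(p (Suc i), s) \<in> alternates D B M ^^ (k - Suc i)"
            unfolding relpow_fun_conv
            by (rule exI[of _ "\<lambda>j. p (Suc i + j)"]) (use i p in auto)
          then have "(h, s) \<in> alternates D B M ^^ Suc (k - Suc i)"
            using p(3)[of 0] p(1) Suc eq by (intro relpow_Suc_I2) auto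
          moreover have "Suc (k - Suc i) < k" using i by linarith
          ultimately show False using shortest by blast
        qed
        then show ?thesis using b by (auto simp: alternates_def M'_def)
      qed
      have "(p 1, s) \<in> alternates D B M' ^^ m"
        unfolding relpow_fun_conv
        by (rule exI[of _ "\<lambda>j. p (Suc j)"]) (use step p Suc in auto)
      then show ?thesis using less.IH[OF _ M' p1 p1'] Suc less.prems(5,6) by blast
    qed
  qed
qed

lemma augment:
  assumes "matching D Sl B M" "h \<in> Sl" "h \<notin> M ` B" "(h, s) \<in> (alternates D B M)\<^sup>*" "w \<in> D s" "w \<notin> B"
  shows "\<exists>M'. matching D Sl (insert w B) M'"
  using augment_relpow[OF assms(1-3) _ assms(5,6)] assms(4) rtrancl_power by blast

context full_plan
begin

lemma Sl_less: "s \<in> Sl \<Longrightarrow> fst s < R"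
  by (cases s) (simp add: Sl_iff)

text \<open>
  The open end of the gap \<open>c\<close> that takes part in the cut, given a set \<open>Y\<close> of slots that meets
  this gap: the end \<open>True\<close> is taken whenever its slot is in \<open>Y\<close>, as it leaves no rejected
  vertex behind.
\<close>

definition node :: "(nat \<times> bool) set \<Rightarrow> nat \<Rightarrow> nat" where
  "node Y c = g c ((c, True) \<in> Y)"

definition lower_only :: "(nat \<times> bool) set \<Rightarrow> nat \<Rightarrow> bool" where
  "lower_only Y c \<longleftrightarrow> (c, False) \<in> Y \<and> (c, True) \<notin> Y"

text \<open>
  The rejected vertex that the end \<open>False\<close> of the gap \<open>c\<close> may leave behind; an arbitrary
  vertex if there is none. In the cut it is charged to the slot \<open>(c, True)\<close>, which
  \<open>lower_only\<close> keeps out of \<open>Y\<close>.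
\<close>

definition survivor :: "nat \<Rightarrow> nat" where
  "survivor c = (SOME e. \<forall>w\<in>N (g c False). w \<le> c \<longrightarrow> w \<in> A \<or> w = e)"

lemma node_short:
  assumes "Y \<subseteq> Sl" "c \<in> fst ` Y" "w \<in> N (node Y c)" "w \<le> c" "w \<notin> A"
  shows "lower_only Y c \<and> w = survivor c"
proof -
  obtain i where i: "(c, i) \<in> Y" using assms(2) by auto
  then have c: "c < R" using assms(1) Sl_iff by auto
  show ?thesis
  proof (cases "(c, True) \<in> Y")
    case True
    then show ?thesis using short_upper[OF c, of w] assms by (simp add: node_def)
  next
    case False
    then have low: "(c, False) \<in> Y" using i by (cases i) auto
    then have "\<not> v \<sqsubseteq> c" using assms(1) Sl_iff by auto
    then have "\<forall>w\<in>N (g c False). w \<le> c \<longrightarrow> w \<in> A \<or> w = survivor c"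
      unfolding survivor_def using someI_ex[OF short_lower[OF c]] by blast
    then show ?thesis using assms False low by (auto simp: node_def lower_only_def)
  qed
qed

lemma node_long:
  assumes "Y \<subseteq> Sl" "c \<in> fst ` Y" "w \<in> N (node Y c)" "c < w" "w \<noteq> v" "w \<noteq> n - 1"
  shows "\<exists>s\<in>Y. w \<in> cand g s"
proof -
  obtain i where i: "(c, i) \<in> Y" using assms(2) by auto
  then have c: "c < R" using assms(1) Sl_iff by auto
  have "(c, (c, True) \<in> Y) \<in> Y" using i by (cases i) (auto, metis (full_types))
  moreover have "w \<in> cand g (c, (c, True) \<in> Y)"
    using assms c by (simp add: cand_iff node_def)
  ultimately show ?thesis by blast
qed

lemma not_matchable:
  assumes "matching (cand g) Sl B M'" "insert w {a \<in> A. a < w} \<subseteq> B" "w < n" "w \<notin> A"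
  shows False
  using greedy[OF assms(3,4)] matching_mono[OF assms(1,2) order_refl] by (auto simp: matchable_def)

lemma slot_anc:
  assumes M: "matching (cand g) Sl A M" and a: "a \<in> A"
  shows "M a \<in> Sl" "par (fst (M a)) \<sqsubseteq> a" "par (fst (M a)) \<notin> P"
proof -
  obtain c i where ci: "M a = (c, i)" by (cases "M a")
  have s: "M a \<in> Sl" "a \<in> cand g (M a)" using M a by (auto simp: matching_def)
  then have c: "c < R" "par c \<notin> P" using ci Sl_iff by auto
  then have "a \<in> N (g c i)" "c < a" using s ci cand_iff by auto
  then have "c \<sqsubseteq> a" using anc_if_le[OF g_anc[OF c(1)] N_anc] by simp
  then have "par c \<sqsubseteq> a" using \<open>c < a\<close> by (cases rule: anc_cases) auto
  then show "M a \<in> Sl" "par (fst (M a)) \<sqsubseteq> a" "par (fst (M a)) \<notin> P" using s c ci by auto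
qed

lemma slot_below_gap:
  assumes M: "matching (cand g) Sl A M" and a: "a \<in> A" and k: "k < R" and ak: "a \<sqsubseteq> k"
  shows "par (fst (M a)) \<sqsubseteq> bs k"
  using below_gap[OF k anc_trans[OF slot_anc(2)[OF M a] ak]] slot_anc(3)[OF M a] by blast

text \<open>
  The cut contains the continuations of one end for each gap met by \<open>Y\<close>. Those above the gap,
  except \<open>v\<close> and \<open>n - 1\<close>, are candidates of slots in \<open>Y\<close>, and they are matched into \<open>Y\<close> if \<open>Y\<close>
  is closed under alternating steps. Those inside the gap are not candidates. Their slots are
  added to \<open>Y\<close>, one gap \<open>k\<close> after the other from the root downwards. New slots lie below the
  gap that causes them, so the gaps above it are not affected.

  The rejected candidates \<open>w\<close> of \<open>Y\<close> must be kept under control. There are none initially,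
  since \<open>w\<close> could be matched by augmentation from the empty slot \<open>s0\<close>. A new slot is reached
  from the slot of some accepted \<open>a\<close> inside the gap. Removing \<open>a\<close> empties that slot, and
  augmentation finds a place for \<open>w\<close>. As \<open>w\<close> was rejected by the greedy rule, it does not
  precede \<open>a\<close>. Hence \<open>w\<close> lies above the end at which \<open>a\<close> is a continuation, so it continues
  this end as well and is either an old candidate or the survivor of the gap.
\<close>

lemma closure_exists:
  assumes M: "matching (cand g) Sl A M" and s0: "s0 \<in> Sl" "s0 \<notin> M ` A" and k: "k \<le> R"
  shows "\<exists>Y\<subseteq>Sl. s0 \<in> Y \<and> (\<forall>s\<in>Y. \<forall>a\<in>A \<inter> cand g s. M a \<in> Y) \<and>
    (\<forall>c\<in>fst ` Y. k \<le> c \<longrightarrow> (\<forall>a\<in>A \<inter> N (node Y c). M a \<in> Y)) \<and>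
    (\<forall>s\<in>Y. \<forall>w\<in>cand g s. w \<in> A \<or> (\<exists>c\<ge>k. lower_only Y c \<and> w = survivor c))"
  using k
proof (induction rule: inc_induct)
  case base
  define Y0 where "Y0 = (alternates (cand g) A M)\<^sup>* `` {s0}"
  have sub: "Y0 \<subseteq> Sl"
  proof
    fix s assume "s \<in> Y0"
    then have "(s0, s) \<in> (alternates (cand g) A M)\<^sup>*" by (simp add: Y0_def)
    then show "s \<in> Sl"
      by (cases rule: rtranclE) (use s0 slot_anc(1)[OF M] in \<open>auto simp: alternates_def\<close>)
  qed
  have "\<forall>s\<in>Y0. \<forall>a\<in>A \<inter> cand g s. M a \<in> Y0"
    by (auto simp: Y0_def alternates_def intro: rtrancl_into_rtrancl)
  moreover have "\<forall>c\<in>fst ` Y0. \<not> R \<le> c"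
    using Sl_less[OF subsetD[OF sub]] by fastforce
  moreover have "w \<in> A" if s: "s \<in> Y0" and w: "w \<in> cand g s" for s w
  proof (rule ccontr)
    assume wA: "w \<notin> A"
    then obtain M' where "matching (cand g) Sl (insert w A) M'"
      using augment[OF M s0 _ w] s by (auto simp: Y0_def)
    then show False using not_matchable[of "insert w A" M' w] wA w later by (auto simp: cand_def)
  qed
  moreover have "s0 \<in> Y0" by (simp add: Y0_def)
  ultimately show ?case using sub by (intro exI[of _ Y0]) auto
next
  case (step k)
  then obtain Y where Y: "Y \<subseteq> Sl" "s0 \<in> Y" "\<forall>s\<in>Y. \<forall>a\<in>A \<inter> cand g s. M a \<in> Y"
    "\<forall>c\<in>fst ` Y. Suc k \<le> c \<longrightarrow> (\<forall>a\<in>A \<inter> N (node Y c). M a \<in> Y)"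
    "\<forall>s\<in>Y. \<forall>w\<in>cand g s. w \<in> A \<or> (\<exists>c\<ge>Suc k. lower_only Y c \<and> w = survivor c)" by auto
  show ?case
  proof (cases "k \<in> fst ` Y")
    case False
    then have "\<forall>c\<in>fst ` Y. k \<le> c \<longrightarrow> Suc k \<le> c" by (metis Suc_leI order_le_imp_less_or_eq)
    moreover have "\<forall>s\<in>Y. \<forall>w\<in>cand g s. w \<in> A \<or> (\<exists>c\<ge>k. lower_only Y c \<and> w = survivor c)"
      using Y(5) Suc_leD by blast
    ultimately show ?thesis using Y by (intro exI[of _ Y]) auto
  next
    case True
    have kR: "k < R" by (rule step.hyps(2))
    define f0 where "f0 = node Y k"
    have f0: "bs k \<sqsubseteq> f0" "f0 \<sqsubseteq> k" using g_anc[OF kR] bs_g[OF kR] by (auto simp: f0_def node_def)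
    \<comment> \<open>the accepted continuations inside the gap \<open>k\<close>\<close>
    define Roots where "Roots = A \<inter> N f0 \<inter> {..k}"
    define r where "r = alternates (cand g) A M"
    define Y' where "Y' = Y \<union> r\<^sup>* `` (M ` Roots)"
    have long: "M a \<in> Y" if "a \<in> A" "a \<in> N f0" "k < a" for a
    proof -
      have "a \<noteq> v" "a \<noteq> n - 1" using that v_A top_A by auto
      then show ?thesis using node_long[OF Y(1) True, of a] that Y(3) by (auto simp: f0_def)
    qed
    have root: "par (fst (M a)) \<sqsubseteq> bs k" if "a \<in> Roots" for a
    proof -
      have "a \<sqsubseteq> k" using that anc_if_le[OF N_anc f0(2), of a] by (auto simp: Roots_def)
      then show ?thesis using slot_below_gap[OF M _ kR] that by (auto simp: Roots_def)
    qed
    \<comment> \<open>the last element of \<open>Roots\<close> on an alternating path is not used again after it, and can be removed\<close>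
    have new: "s \<in> Y \<or> s \<in> Sl \<and>
        (\<exists>a\<in>Roots. (M a, s) \<in> (alternates (cand g) (A - {a}) M)\<^sup>* \<and> par (fst s) \<sqsubseteq> bs k)"
      if b: "b \<in> Roots" and s: "(M b, s) \<in> r\<^sup>*" for b s
      using s
    proof (induction rule: rtrancl_induct)
      case base
      then show ?case using b root slot_anc(1)[OF M] by (auto simp: Roots_def)
    next
      case (step s s')
      obtain a where a: "a \<in> A" "a \<in> cand g s" "s' = M a" using step.hyps(2) by (auto simp: r_def alternates_def)
      have s'Sl: "s' \<in> Sl" using slot_anc(1)[OF M] a by auto
      show ?case
      proof (cases "s \<in> Y")
        case True
        then show ?thesis using Y(3) a by blast
      next
        case False
        then obtain a0 where a0: "a0 \<in> Roots" "(M a0, s) \<in> (alternates (cand g) (A - {a0}) M)\<^sup>*"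
          "par (fst s) \<sqsubseteq> bs k" "s \<in> Sl" using step.IH by blast
        obtain c i where ci: "s = (c, i)" by (cases s)
        have c: "c < R" using a0(4) ci Sl_iff by auto
        have aN: "a \<in> N (g c i)" using a(2) ci cand_iff[OF c] by auto
        have gf: "g c i \<sqsubseteq> f0"
          using anc_trans[OF anc_trans[OF anc_trans[OF g_anc[OF c] anc_par[OF lt_R[OF c]]]] f0(1)] a0(3) ci
          by simp
        consider "a \<in> Roots" | "a \<in> N f0" "k < a" | "a \<le> f0" "a \<notin> Roots"
          using N_up[OF gf aN] a(1) by (force simp: Roots_def)
        then show ?thesis
        proof cases
          case 1
          then show ?thesis using root a(3) s'Sl by blast
        next
          case 2
          then show ?thesis using long a by blast
        next
          case 3
          have "a \<sqsubseteq> f0" by (rule anc_if_le[OF N_anc[OF aN] gf 3(1)])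
          then have "par (fst s') \<sqsubseteq> bs k"
            using slot_below_gap[OF M a(1) kR] anc_trans[OF _ f0(2)] a(3) by blast
          moreover have "(s, s') \<in> alternates (cand g) (A - {a0}) M"
            using a a0(1) 3(2) by (auto simp: alternates_def)
          ultimately show ?thesis using a0 s'Sl rtrancl_into_rtrancl by fast
        qed
      qed
    qed
    have new': "s \<in> Y \<or> s \<in> Sl \<and>
        (\<exists>a\<in>Roots. (M a, s) \<in> (alternates (cand g) (A - {a}) M)\<^sup>* \<and> par (fst s) \<sqsubseteq> bs k)"
      if "s \<in> Y'" for s
      using that new unfolding Y'_def by blast
    have sub: "Y' \<subseteq> Sl" using new' Y(1) by blast
    have low: "fst s < k" if "s \<in> Y'" "s \<notin> Y" for s
    proof -
      have s: "s \<in> Sl" "par (fst s) \<sqsubseteq> bs k" using new'[OF that(1)] that(2) by blast+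
      then have "fst s < R" by (cases s) (simp add: Sl_iff)
      then have "fst s < par (fst s)" using par_gt lt_R by blast
      also have "par (fst s) \<le> k" using anc_le[OF s(2)] anc_le[OF bs_anc[OF kR]] by simp
      finally show ?thesis .
    qed
    have same: "(c, i) \<in> Y' \<longleftrightarrow> (c, i) \<in> Y" if "k \<le> c" for c i
      using low[of "(c, i)"] that by (auto simp: Y'_def)
    have node_same: "node Y' c = node Y c" "lower_only Y' c \<longleftrightarrow> lower_only Y c" if "k \<le> c" for c
      using same[OF that] by (auto simp: node_def lower_only_def)
    have fst_same: "c \<in> fst ` Y' \<longleftrightarrow> c \<in> fst ` Y" if "k \<le> c" for c
      using same[OF that] by force
    have closed: "M a \<in> Y'" if s: "s \<in> Y'" and a: "a \<in> A \<inter> cand g s" for s a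
    proof (cases "s \<in> Y")
      case True
      then show ?thesis using Y(3) a by (auto simp: Y'_def)
    next
      case False
      then have "s \<in> r\<^sup>* `` (M ` Roots)" using s by (auto simp: Y'_def)
      moreover have "(s, M a) \<in> r" using a by (auto simp: r_def alternates_def)
      ultimately have "M a \<in> r\<^sup>* `` (M ` Roots)" by (auto intro: rtrancl_into_rtrancl)
      then show ?thesis by (simp add: Y'_def)
    qed
    have down: "M a \<in> Y'" if c: "c \<in> fst ` Y'" "k \<le> c" and a: "a \<in> A \<inter> N (node Y' c)" for c a
    proof (cases "c = k")
      case True
      then have "a \<in> N f0" using a node_same[of k] by (simp add: f0_def)
      then show ?thesis using long[of a] a by (cases "a \<le> k") (auto simp: Y'_def Roots_def)
    next
      case False
      then have "M a \<in> Y" using Y(4) c a fst_same node_same by auto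
      then show ?thesis by (simp add: Y'_def)
    qed
    have exc: "w \<in> A \<or> (\<exists>c\<ge>k. lower_only Y' c \<and> w = survivor c)"
      if s: "s \<in> Y'" and w: "w \<in> cand g s" for s w
    proof -
      have old: ?thesis if sY: "s \<in> Y" "w \<in> cand g s" for s
      proof (cases "w \<in> A")
        case False
        have "w \<in> A \<or> (\<exists>c\<ge>Suc k. lower_only Y c \<and> w = survivor c)"
          using bspec[OF bspec[OF Y(5) sY(1)] sY(2)] .
        then obtain c where "Suc k \<le> c" "lower_only Y c" "w = survivor c" using False by auto
        then show ?thesis using node_same(2)[of c] by (intro disjI2 exI[of _ c]) auto
      qed simp
      show ?thesis
      proof (cases "s \<in> Y \<or> w \<in> A")
        case True
        then show ?thesis using old w by blast
      next
        case False
        then obtain a where a: "a \<in> Roots" "(M a, s) \<in> (alternates (cand g) (A - {a}) M)\<^sup>*"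
          "par (fst s) \<sqsubseteq> bs k" "s \<in> Sl" using new'[OF s] by blast
        have wn: "w < n" "w \<noteq> v" "w \<noteq> n - 1" using w later by (auto simp: cand_def)
        have "M a \<notin> M ` (A - {a})" using M a(1) by (auto simp: matching_def inj_on_def Roots_def)
        moreover have "matching (cand g) Sl (A - {a}) M" by (rule matching_mono[OF M]) auto
        moreover have "M a \<in> Sl" using slot_anc(1)[OF M] a(1) by (auto simp: Roots_def)
        ultimately obtain M' where M': "matching (cand g) Sl (insert w (A - {a})) M'"
          using augment[of "cand g" Sl "A - {a}" M "M a" s w] a(2) w False by auto
        have "\<not> w < a"
        proof
          assume "w < a"
          then have "insert w {b \<in> A. b < w} \<subseteq> insert w (A - {a})" by auto
          then show False using not_matchable[OF M' _ wn(1)] False by blast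
        qed
        moreover have "a \<in> N f0" "a \<in> A" using a(1) by (auto simp: Roots_def)
        ultimately have wf: "f0 < w" using later[of a f0] False by force
        obtain c i where ci: "s = (c, i)" by (cases s)
        have c: "c < R" using a(4) ci Sl_iff by auto
        have gf: "g c i \<sqsubseteq> f0"
          using anc_trans[OF anc_trans[OF anc_trans[OF g_anc[OF c] anc_par[OF lt_R[OF c]]]] f0(1)] a(3) ci
          by simp
        have wN: "w \<in> N f0" using N_up[OF gf _ wf] w ci cand_iff[OF c] by auto
        show ?thesis
        proof (cases "k < w")
          case True
          then show ?thesis
            using node_long[OF Y(1) \<open>k \<in> fst ` Y\<close>, of w] wN wn old by (auto simp: f0_def)
        next
          case False
          then have "lower_only Y k \<and> w = survivor k"
            using node_short[OF Y(1) \<open>k \<in> fst ` Y\<close>, of w] wN \<open>\<not> (s \<in> Y \<or> w \<in> A)\<close> by (auto simp: f0_def)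
          then show ?thesis using node_same(2)[of k] by auto
        qed
      qed
    qed
    have "s0 \<in> Y'" using Y(2) by (simp add: Y'_def)
    then show ?thesis using sub closed down exc by (intro exI[of _ Y']) auto
  qed
qed

text \<open>
  The cut consists of accepted vertices matched into \<open>Y - {s0}\<close>, at most one survivor for
  every gap with only its slot \<open>False\<close> in \<open>Y\<close>, and possibly \<open>v\<close> and \<open>n - 1\<close>. Counting a
  survivor as the missing slot \<open>True\<close> of its gap gives at most \<open>2 * card C - 1 + 2\<close>.
\<close>

lemma deficient_cut:
  assumes M: "matching (cand g) Sl A M" and s0: "s0 \<in> Sl" "s0 \<notin> M ` A"
  obtains C h where "C \<subseteq> {c. c < R \<and> par c \<notin> P}" "C \<noteq> {}" "\<And>c. c \<in> C \<Longrightarrow> \<exists>i. h c = g c i"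
    "card (\<Union>c\<in>C. N (h c)) \<le> 2 * card C + 1"
proof -
  obtain Y where Y: "Y \<subseteq> Sl" "s0 \<in> Y" "\<forall>s\<in>Y. \<forall>a\<in>A \<inter> cand g s. M a \<in> Y"
    "\<forall>c\<in>fst ` Y. \<forall>a\<in>A \<inter> N (node Y c). M a \<in> Y"
    "\<forall>s\<in>Y. \<forall>w\<in>cand g s. w \<in> A \<or> (\<exists>c. lower_only Y c \<and> w = survivor c)"
    using closure_exists[OF M s0, of 0] by auto
  define C where "C = fst ` Y"
  define Lo where "Lo = {c \<in> C. lower_only Y c}"
  have C: "C \<subseteq> {c. c < R \<and> par c \<notin> P}"
  proof
    fix c assume "c \<in> C"
    then obtain i where "(c, i) \<in> Y" by (auto simp: C_def)
    then have "(c, i) \<in> Sl" using Y(1) by blast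
    then show "c \<in> {c. c < R \<and> par c \<notin> P}" by (simp add: Sl_iff)
  qed
  then have finC: "finite C" by (rule finite_subset) simp
  have YC: "Y \<subseteq> C \<times> UNIV" by (force simp: C_def)
  then have finY: "finite Y" by (rule finite_subset) (simp add: finC)
  let ?S = "\<Union>c\<in>C. N (node Y c)"
  have sub: "?S \<subseteq> {a \<in> A. M a \<in> Y} \<union> survivor ` Lo \<union> {v, n - 1}"
  proof
    fix w assume "w \<in> ?S"
    then obtain c where c: "c \<in> fst ` Y" "w \<in> N (node Y c)" by (auto simp: C_def)
    show "w \<in> {a \<in> A. M a \<in> Y} \<union> survivor ` Lo \<union> {v, n - 1}"
    proof (cases "w \<in> A \<or> w = v \<or> w = n - 1")
      case True
      then show ?thesis using Y(4) c by auto
    next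
      case False
      then have "\<exists>c. lower_only Y c \<and> w = survivor c"
        using node_short[OF Y(1) c] node_long[OF Y(1) c] Y(5) by (metis not_le)
      then obtain c' where "lower_only Y c'" "w = survivor c'" by blast
      moreover then have "c' \<in> C" by (force simp: lower_only_def C_def)
      ultimately show ?thesis by (auto simp: Lo_def)
    qed
  qed
  have finLo: "finite Lo" using finC by (simp add: Lo_def)
  have "card {a \<in> A. M a \<in> Y} \<le> card (Y - {s0})"
  proof (rule card_inj_on_le[of M])
    show "inj_on M {a \<in> A. M a \<in> Y}" using M by (auto simp: matching_def inj_on_def)
    show "M ` {a \<in> A. M a \<in> Y} \<subseteq> Y - {s0}" using s0 by auto
  qed (use finY in simp)
  moreover have "card (survivor ` Lo) \<le> card Lo" by (rule card_image_le[OF finLo])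
  moreover have "card {v, n - 1} \<le> 2" by (simp add: card_insert_if)
  moreover have "card ?S \<le> card ({a \<in> A. M a \<in> Y} \<union> survivor ` Lo \<union> {v, n - 1})"
    using sub finLo A_sub by (intro card_mono) (auto intro: finite_subset[of _ "{..<n}"])
  moreover have "\<dots> \<le> card {a \<in> A. M a \<in> Y} + card (survivor ` Lo) + card {v, n - 1}"
    by (meson add_le_mono card_Un_le order_refl order_trans)
  moreover have "card (Y - {s0}) + 1 = card Y"
    using Y(2) finY by (metis Suc_eq_plus1 card_Suc_Diff1)
  moreover have "card Y + card Lo \<le> 2 * card C"
  proof -
    have "card Y + card Lo = card (Y \<union> (\<lambda>c. (c, True)) ` Lo)"
      using finY finLo
      by (subst card_Un_disjoint) (auto simp: Lo_def lower_only_def card_image inj_on_def)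
    also have "\<dots> \<le> card (C \<times> (UNIV :: bool set))"
      using YC finC by (intro card_mono) (auto simp: Lo_def)
    finally show ?thesis by (simp add: card_cartesian_product)
  qed
  ultimately have "card ?S \<le> 2 * card C + 1" by linarith
  moreover have "C \<noteq> {}" using Y(2) by (auto simp: C_def)
  ultimately show ?thesis using that[of C "node Y"] C by (auto simp: node_def)
qed

end

section \<open>The pieces that the cut leaves\<close>

context elimination_order
begin

text \<open>A leaf is nobody's later neighbour. So it survives every cut that is a union of sets \<open>N y\<close>.\<close>

lemma leaf_below: "\<exists>l. l \<sqsubseteq> x \<and> (\<forall>y. l \<notin> N y)"
proof (induction x rule: less_induct)
  case (less x)
  show ?case
  proof (cases "\<exists>y. x \<in> N y")
    case True
    then obtain y where "x \<in> N y" by blast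
    then have "y < x" "y \<sqsubseteq> x" using later N_anc by auto
    then show ?thesis using less.IH[of y] anc_trans[OF _ \<open>y \<sqsubseteq> x\<close>] by blast
  next
    case False
    then show ?thesis by (intro exI[of _ x]) auto
  qed
qed

end

context full_plan
begin

text \<open>
  Both upper ends lie above \<open>bs c\<close> on one branch of the tree, and the parent of the lower one
  would be a passing node of the gap that ends in the other.
\<close>

lemma gap_unique:
  assumes "c < R" "par c \<notin> P" "c' < R" "par c' \<notin> P" "bs c = bs c'"
  shows "c = c'"
proof -
  have *: "c = c'" if c: "c < R" "par c \<notin> P" "c' < R" "bs c = bs c'" "c \<sqsubseteq> c'" for c c'
    using c(5)
  proof (cases rule: anc_cases)
    case 2
    have p: "c < par c" "c \<sqsubseteq> par c" using par_gt anc_par lt_R[OF c(1)] by auto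
    have "bs c \<le> c" by (rule anc_le[OF bs_anc[OF c(1)]])
    then have "par c \<noteq> bs c'" using p c by simp
    moreover have "bs c' \<sqsubseteq> par c" using anc_trans[OF bs_anc[OF c(1)] p(2)] c(4) by simp
    ultimately have "par c \<in> P" using bs_between[OF c(3) _ 2(2)] by blast
    then show ?thesis using c(2) by simp
  qed
  have "bs c \<sqsubseteq> c" "bs c \<sqsubseteq> c'" using bs_anc[of c] bs_anc[of c'] assms by auto
  then show ?thesis using anc_linear[of "bs c" c c'] *[of c c'] *[of c' c] assms by auto
qed

text \<open>
  Removing \<open>N f\<close> separates the subtree of \<open>f\<close> from the rest of the graph, as the later
  neighbours of this subtree above \<open>f\<close> all belong to \<open>N f\<close>. For \<open>F = h ` C\<close> this divides the
  tree into \<open>card F + 1\<close> pieces, labelled by their topmost vertex \<open>f \<in> F\<close>, and by \<open>n\<close> for the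
  piece of the root. The labels do not change along edges outside the cut.

  A piece is vacant if the cut contains all of it. Its kids are the pieces that hang below it.
  A vacant piece has two kids: below every child of the lower end of its gap there is a leaf,
  which survives, so there is a kid. If this lower end \<open>x\<close> had one child only, then, as an
  element of the cut, \<open>x\<close> would continue the end \<open>True\<close> below it and would have been appended.
  Only a piece whose gap starts in \<open>v\<close> may have a single kid. For the piece of the root, two
  kids come from the choice of \<open>R\<close>. Since the numbers of kids add up to \<open>card F\<close>, at most half
  of the \<open>card F + 1\<close> pieces are vacant.
\<close>

lemma cut_pieces:
  assumes C: "C \<subseteq> {c. c < R \<and> par c \<notin> P}" "C \<noteq> {}"
    and h: "\<And>c. c \<in> C \<Longrightarrow> \<exists>i. h c = g c i"
  defines "S \<equiv> \<Union>c\<in>C. N (h c)"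
  obtains lab :: "nat \<Rightarrow> nat" and Q where
    "\<And>x y. y \<in> N x \<Longrightarrow> x \<notin> S \<Longrightarrow> y \<notin> S \<Longrightarrow> lab x = lab y"
    "Q \<subseteq> {..<n} - S" "inj_on lab Q" "2 \<le> card Q" "card C + 1 \<le> 2 * card Q"
proof -
  have finC: "finite C" by (rule finite_subset[OF C(1)]) simp
  have Cd: "c < R" "par c \<notin> P" if "c \<in> C" for c using C(1) that by auto
  have hd: "bs c \<sqsubseteq> h c" "h c \<sqsubseteq> c" "bs (h c) = bs c" "h c < R" if c: "c \<in> C" for c
  proof -
    obtain i where i: "h c = g c i" using h[OF c] by blast
    show a: "bs c \<sqsubseteq> h c" "h c \<sqsubseteq> c" using bs_g g_anc Cd[OF c] i by auto
    show "bs (h c) = bs c" using bs_between[OF Cd(1)[OF c] a] by simp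
    show "h c < R" using anc_le[OF a(2)] Cd[OF c] by simp
  qed
  define F where "F = h ` C"
  have inj_bs: "c = c'" if "c \<in> C" "c' \<in> C" "bs c = bs c'" for c c'
    using gap_unique Cd that by blast
  have inj_h: "inj_on h C" by (rule inj_onI, rule inj_bs) (metis hd(3))+
  have finF: "finite F" and F_ne: "F \<noteq> {}" and cardF: "card F = card C"
    using finC C(2) inj_h by (auto simp: F_def card_image)
  have F_R: "f < R" if "f \<in> F" for f using that hd(4) by (auto simp: F_def)
  have F_n: "Suc f < n" if "f \<in> F" for f using lt_R[OF F_R[OF that]] .
  have S_iff: "x \<in> S \<longleftrightarrow> (\<exists>f\<in>F. x \<in> N f)" for x by (auto simp: S_def F_def)
  have F_bs: "f = f'" if ff: "f \<in> F" "f' \<in> F" "bs f = bs f'" for f f'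
  proof -
    obtain c c' where "c \<in> C" "f = h c" "c' \<in> C" "f' = h c'" using ff(1,2) by (auto simp: F_def)
    then show ?thesis using inj_bs[of c c'] hd(3)[of c] hd(3)[of c'] ff(3) by simp
  qed
  have F_between: "f' = f" if f: "f \<in> F" and f': "f' \<in> F" "bs f \<sqsubseteq> f'" "f' \<sqsubseteq> f" for f f'
  proof -
    obtain c where c: "c \<in> C" "f = h c" using f by (auto simp: F_def)
    have "bs f' = bs f"
      using bs_between[OF F_R[OF f] f'(2,3)] by simp
    then show ?thesis using F_bs[OF f'(1) f] by simp
  qed
  have F_bs_anc: "bs f \<sqsubseteq> f" if "f \<in> F" for f using bs_anc[OF F_R[OF that]] .
  define lab where "lab x = (if \<exists>f\<in>F. x \<sqsubseteq> f then Min {f \<in> F. x \<sqsubseteq> f} else n)" for x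
  have lab_F: "lab x \<in> F \<and> x \<sqsubseteq> lab x" if "f \<in> F" "x \<sqsubseteq> f" for x f
  proof -
    have "Min {f \<in> F. x \<sqsubseteq> f} \<in> {f \<in> F. x \<sqsubseteq> f}"
      by (rule Min_in) (use finF that in auto)
    then show ?thesis using that by (auto simp: lab_def)
  qed
  have lab_le: "lab x \<le> f" if "f \<in> F" "x \<sqsubseteq> f" for x f
    using that finF by (auto simp: lab_def)
  have lab_n: "lab x = n \<longleftrightarrow> \<not> (\<exists>f\<in>F. x \<sqsubseteq> f)" for x
  proof
    assume eq: "lab x = n"
    show "\<not> (\<exists>f\<in>F. x \<sqsubseteq> f)"
    proof
      assume "\<exists>f\<in>F. x \<sqsubseteq> f"
      then have "lab x \<in> F" using lab_F by blast
      then show False using F_n[of n] eq by simp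
    qed
  qed (simp add: lab_def)
  have labI: "lab x = f" if "f \<in> F" "x \<sqsubseteq> f" "\<And>f'. f' \<in> F \<Longrightarrow> x \<sqsubseteq> f' \<Longrightarrow> f \<le> f'" for x f
    using lab_F[OF that(1,2)] lab_le[OF that(1,2)] that(3) by (simp add: order_antisym)
  have lab_const: "lab x = lab y" if xy: "y \<in> N x" "x \<notin> S" "y \<notin> S" for x y
  proof -
    have "x \<sqsubseteq> f \<longleftrightarrow> y \<sqsubseteq> f" if f: "f \<in> F" for f
    proof
      assume xf: "x \<sqsubseteq> f"
      have "\<not> f < y" using N_up[OF xf xy(1)] xy(3) f by (auto simp: S_iff)
      then show "y \<sqsubseteq> f" using anc_if_le[OF N_anc[OF xy(1)] xf] by simp
    qed (rule anc_trans[OF N_anc[OF xy(1)]])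
    then have "{f \<in> F. x \<sqsubseteq> f} = {f \<in> F. y \<sqsubseteq> f}" "(\<exists>f\<in>F. x \<sqsubseteq> f) \<longleftrightarrow> (\<exists>f\<in>F. y \<sqsubseteq> f)" by auto
    then show ?thesis by (simp add: lab_def)
  qed
  \<comment> \<open>pieces are identified with their labels\<close>
  define kids where "kids p = {f \<in> F. lab (par f) = p}" for p
  define vac where "vac p \<longleftrightarrow> (\<forall>w<n. lab w = p \<longrightarrow> w \<in> S)" for p
  have fin_kids: "finite (kids p)" for p using finF by (simp add: kids_def)
  have leaf: "\<exists>l. l \<sqsubseteq> x \<and> l \<notin> S \<and> l < n" if "x < n" for x
    using leaf_below[of x] that anc_less by (auto simp: S_iff)
  have kid_below: "\<exists>f'\<in>kids f. f' \<sqsubseteq> d" if f: "f \<in> F" "vac f" and d: "d \<in> ch (bs f)" for f d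
  proof -
    have dd: "d < R" "par d = bs f" "d \<sqsubseteq> bs f" using d ch_anc[OF d] by (auto simp: ch_def)
    obtain l where l: "l \<sqsubseteq> d" "l \<notin> S" "l < n" using leaf[of d] lt_R[OF dd(1)] by auto
    have lb: "l \<sqsubseteq> bs f" by (rule anc_trans[OF l(1) dd(3)])
    have lf: "l \<sqsubseteq> f" by (rule anc_trans[OF lb F_bs_anc[OF f(1)]])
    define m where "m = lab l"
    have m: "m \<in> F" "l \<sqsubseteq> m" "m \<le> f" using lab_F[OF f(1) lf] lab_le[OF f(1) lf] by (auto simp: m_def)
    have "m \<noteq> f" using f(2) l by (auto simp: vac_def m_def)
    have low: "f' < bs f" if "f' \<in> F" "l \<sqsubseteq> f'" "f' < f" for f'
    proof (rule ccontr)
      assume "\<not> f' < bs f"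
      then have "bs f \<sqsubseteq> f'" using anc_if_le[OF lb that(2)] by simp
      moreover have "f' \<sqsubseteq> f" using anc_if_le[OF that(2) lf] that(3) by simp
      ultimately show False using F_between[OF f(1) that(1)] that(3) by simp
    qed
    \<comment> \<open>the highest cut point between the leaf and the gap of \<open>f\<close> hangs directly below the piece of \<open>f\<close>\<close>
    let ?X = "{f' \<in> F. l \<sqsubseteq> f' \<and> f' < bs f}"
    have "m \<in> ?X" using low[OF m(1,2)] m \<open>m \<noteq> f\<close> by simp
    then have Max: "Max ?X \<in> ?X" using finF by (intro Max_in) auto
    define f1 where "f1 = Max ?X"
    have f1: "f1 \<in> F" "l \<sqsubseteq> f1" "f1 < bs f" using Max by (auto simp: f1_def)
    have f1b: "f1 \<sqsubseteq> bs f" using anc_if_le[OF f1(2) lb] f1(3) by simp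
    have bR: "bs f \<le> R" using bs_R[OF F_R[OF f(1)]] by simp
    obtain d' where d': "d' \<in> ch (bs f)" "f1 \<sqsubseteq> d'" using anc_ch[OF f1b _ bR] f1(3) by auto
    have "d' = d" by (rule ch_disjoint[OF d'(1) d anc_trans[OF f1(2) d'(2)] l(1)])
    have parb: "par f1 \<sqsubseteq> bs f" using f1b by (cases rule: anc_cases) (use f1(3) in auto)
    have "lab (par f1) = f"
    proof (rule labI)
      show "f \<in> F" by (rule f(1))
      show "par f1 \<sqsubseteq> f" by (rule anc_trans[OF parb F_bs_anc[OF f(1)]])
      fix f' assume f': "f' \<in> F" "par f1 \<sqsubseteq> f'"
      have lf': "l \<sqsubseteq> f'" by (rule anc_trans[OF anc_trans[OF f1(2) anc_par[OF F_n[OF f1(1)]]] f'(2)])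
      show "f \<le> f'"
      proof (rule ccontr)
        assume "\<not> f \<le> f'"
        then have "f' \<in> ?X" using low[OF f'(1) lf'] f'(1) lf' by simp
        then have "f' \<le> f1" using finF by (simp add: f1_def)
        moreover have "f1 < f'" using par_gt[OF F_n[OF f1(1)]] anc_le[OF f'(2)] by simp
        ultimately show False by simp
      qed
    qed
    then show ?thesis using f1(1) d' \<open>d' = d\<close> by (auto simp: kids_def)
  qed
  have bs_piece: "bs f \<in> S" if f: "f \<in> F" "vac f" for f
  proof -
    have "lab (bs f) = f"
      by (rule labI[OF f(1) F_bs_anc[OF f(1)]])
        (metis F_between anc_linear F_bs_anc anc_le f(1) order_refl)
    moreover have "bs f < n" using bs_R[OF F_R[OF f(1)]] R_less by simp
    ultimately show ?thesis using f(2) by (auto simp: vac_def)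
  qed
  have bs_ch: "ch (bs f) \<noteq> {}" if f: "f \<in> F" "vac f" for f
  proof -
    obtain y where y: "bs f \<in> N y" using bs_piece[OF f] by (auto simp: S_iff)
    then have "y \<sqsubseteq> bs f" "y \<noteq> bs f" using N_anc later by auto
    then show ?thesis using anc_ch[of y "bs f"] bs_R[OF F_R[OF f(1)]] by auto
  qed
  have kids_ne: "kids f \<noteq> {}" if "f \<in> F" "vac f" for f
    using bs_ch[OF that] kid_below[OF that] by blast
  have two_ch: "ch (bs f) \<noteq> {d}" if f: "f \<in> F" "vac f" and v: "bs f \<noteq> v" for f d
  proof
    assume d: "ch (bs f) = {d}"
    let ?b = "bs f"
    have b: "?b < R" "?b \<notin> P" using bs_R[OF F_R[OF f(1)]] gap_order[OF F_R[OF f(1)]] by auto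
    have dd: "d < R" "par d = ?b" "d < ?b" "d \<in> ch ?b" using d ch_lt[of d ?b] by (auto simp: ch_def)
    obtain y where y: "y \<in> F" "?b \<in> N y" using bs_piece[OF f] by (auto simp: S_iff)
    have "y \<sqsubseteq> d"
      using only_child[OF d _ N_anc[OF y(2)]] b(1) later[OF y(2)] by auto
    then consider "y \<sqsubseteq> bs d" | "bs y = bs d" using below_gap[OF dd(1)] by blast
    then have "y \<sqsubseteq> g d True"
    proof cases
      case 1
      then show ?thesis by (rule anc_trans[OF _ bs_g[OF dd(1)]])
    next
      case 2
      obtain c where c: "c \<in> C" "y = h c" using y(1) by (auto simp: F_def)
      then have "bs c = bs d" using hd(3) 2 by simp
      then have "c = d" using gap_unique[OF Cd[OF c(1)] dd(1)] dd(2) b(2) by simp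
      then obtain i where "y = g d i" using h[OF c(1)] c(2) by auto
      then show ?thesis using gap_order[OF dd(1)] by (cases i) auto
    qed
    moreover have "g d True < ?b" using anc_le[OF g_anc[OF dd(1), of True]] dd(3) by simp
    ultimately have "?b \<in> N (g d True)" using N_up y(2) by blast
    moreover have "?b < n" using b(1) R_less by simp
    ultimately show False using event1[OF _ b v d] by blast
  qed
  have two_kids: "2 \<le> card (kids f)" if f: "f \<in> F" "vac f" and v: "bs f \<noteq> v" for f
  proof -
    obtain d where d: "d \<in> ch (bs f)" using bs_ch[OF f] by blast
    then obtain d' where d': "d' \<in> ch (bs f)" "d' \<noteq> d" using two_ch[OF f v, of d] by blast
    obtain k k' where k: "k \<in> kids f" "k \<sqsubseteq> d" "k' \<in> kids f" "k' \<sqsubseteq> d'"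
      using kid_below[OF f d] kid_below[OF f d'(1)] by blast
    then have "k \<noteq> k'" using ch_disjoint[OF d d'(1)] d'(2) by blast
    then have "card {k, k'} = 2" by simp
    moreover have "card {k, k'} \<le> card (kids f)" using k by (intro card_mono fin_kids) auto
    ultimately show ?thesis by simp
  qed
  have top_kids: "2 \<le> card (kids n)" if vn: "vac n"
  proof (rule ccontr)
    assume less: "\<not> 2 \<le> card (kids n)"
    define f where "f = Max F"
    have f: "f \<in> F" using Max_in[OF finF F_ne] by (simp add: f_def)
    have f_max: "f' \<le> f" if "f' \<in> F" for f' using that finF by (simp add: f_def)
    have "lab (par f) = n"
      unfolding lab_n using par_gt[OF F_n[OF f]] anc_le f_max by fastforce
    then have "f \<in> kids n" using f by (simp add: kids_def)
    then have kids: "kids n = {f}"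
      using less fin_kids[of n] card_le_Suc0_iff_eq[of "kids n"] by auto
    have below: "f' \<sqsubseteq> f" if "f' \<in> F" for f'
      using that
    proof (induction "n - f'" arbitrary: f' rule: less_induct)
      case less
      show ?case
      proof (cases "lab (par f') = n")
        case True
        then have "f' \<in> kids n" using less.prems unfolding kids_def by blast
        then show ?thesis unfolding kids by simp
      next
        case False
        then obtain f'' where "f'' \<in> F" "par f' \<sqsubseteq> f''" using lab_n by blast
        moreover have "f' < f''"
          using par_gt[OF F_n[OF less.prems]] anc_le[OF \<open>par f' \<sqsubseteq> f''\<close>] by simp
        moreover have "n - f'' < n - f'" using \<open>f' < f''\<close> F_n[OF less.prems] by simp
        ultimately have "f'' \<sqsubseteq> f" using less.hyps by blast
        then show ?thesis
          using anc_trans[OF anc_trans[OF anc_par[OF F_n[OF less.prems]] \<open>par f' \<sqsubseteq> f''\<close>]] by blast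
      qed
    qed
    have "x \<in> N f" if x: "f < x" "x < n" for x
    proof -
      obtain l where l: "l \<sqsubseteq> x" "l \<notin> S" "l < n" using leaf[OF x(2)] by blast
      then have "lab l \<noteq> n" using vn by (auto simp: vac_def)
      then obtain f' where "f' \<in> F" "l \<sqsubseteq> f'" using lab_n by blast
      then have "l \<sqsubseteq> f" using below anc_trans by blast
      have "lab x = n" unfolding lab_n using anc_le f_max x(1) by fastforce
      then have "x \<in> S" using vn x(2) by (auto simp: vac_def)
      then obtain f'' where "f'' \<in> F" "x \<in> N f''" by (auto simp: S_iff)
      then show "x \<in> N f" using N_up[OF below] x(1) by blast
    qed
    \<comment> \<open>a single kid would make \<open>f\<close> and all vertices after it a clique, against the choice of \<open>R\<close>\<close>
    then have "N f = {f<..<n}" using later by fastforce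
    then show False using not_R[OF F_R[OF f]] by blast
  qed
  define V where "V = {p \<in> insert n F. vac p}"
  have n_F: "n \<notin> F" using F_n by force
  have finV: "finite V" using finF by (simp add: V_def)
  have "card F = card (\<Union>p\<in>insert n F. kids p)"
  proof -
    have "lab x \<in> insert n F" for x using lab_F[of _ x] lab_n[of x] by blast
    then have "(\<Union>p\<in>insert n F. kids p) = F" by (auto simp: kids_def)
    then show ?thesis by simp
  qed
  also have "\<dots> = (\<Sum>p\<in>insert n F. card (kids p))"
    using finF fin_kids by (intro card_UN_disjoint) (auto simp: kids_def)
  finally have sum_kids: "card F = (\<Sum>p\<in>insert n F. card (kids p))" .
  have "(\<Sum>p\<in>V. card (kids p)) \<le> card F"
    unfolding sum_kids using finF by (intro sum_mono2) (auto simp: V_def)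
  moreover have "2 * card V \<le> (\<Sum>p\<in>V. card (kids p)) + 1"
  proof -
    have two: "2 \<le> card (kids p)" if "p \<in> V" "p = n \<or> bs p \<noteq> v" for p
      using that two_kids top_kids by (auto simp: V_def)
    have one: "1 \<le> card (kids p)" if "p \<in> V" for p
      using that kids_ne top_kids fin_kids[of p]
      by (cases "p = n") (auto simp: V_def Suc_le_eq card_gt_0_iff)
    show ?thesis
    proof (cases "\<exists>p\<in>V. p \<noteq> n \<and> bs p = v")
      case False
      then have "(\<Sum>p\<in>V. 2) \<le> (\<Sum>p\<in>V. card (kids p))" using two by (intro sum_mono) blast
      then show ?thesis by simp
    next
      case True
      then obtain p where p: "p \<in> V" "p \<noteq> n" "bs p = v" by blast
      have "2 \<le> card (kids q)" if "q \<in> V - {p}" for q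
      proof (cases "q = n")
        case False
        then have "bs q \<noteq> v" using F_bs[of q p] that p by (auto simp: V_def)
        then show ?thesis using two that by auto
      qed (use two that in auto)
      then have "(\<Sum>q\<in>V - {p}. 2) \<le> (\<Sum>q\<in>V - {p}. card (kids q))" by (intro sum_mono) blast
      moreover have "(\<Sum>q\<in>V. card (kids q)) = card (kids p) + (\<Sum>q\<in>V - {p}. card (kids q))"
        by (rule sum.remove[OF finV p(1)])
      moreover have "card V = Suc (card (V - {p}))" using finV p(1) by (metis card_Suc_Diff1)
      ultimately show ?thesis using one[OF p(1)] by simp
    qed
  qed
  ultimately have cardV: "2 * card V \<le> card F + 1" by linarith
  \<comment> \<open>for a single cut point the count alone would allow one surviving piece; in fact both survive\<close>
  have small: "V = {}" if F1: "card F = 1"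
  proof (rule ccontr)
    assume "V \<noteq> {}"
    then obtain p where p: "p \<in> V" by blast
    obtain f where f: "F = {f}" using F1 by (rule card_1_singletonE)
    show False
    proof (cases "p = n")
      case True
      then have "2 \<le> card (kids n)" using top_kids p by (auto simp: V_def)
      moreover have "card (kids n) \<le> card F" using finF by (intro card_mono) (auto simp: kids_def)
      ultimately show False using F1 by simp
    next
      case False
      then have pf: "p = f" "vac f" "f \<in> F" using p f by (auto simp: V_def)
      then obtain f' where "f' \<in> kids f" using kids_ne by blast
      then have "lab (par f) = f" using f by (auto simp: kids_def)
      moreover have "lab (par f) \<noteq> n" using calculation n_F pf by auto
      ultimately have "par f \<sqsubseteq> f" using lab_n[of "par f"] f by fastforce
      then show False using anc_le par_gt[OF F_n[OF pf(3)]] by fastforce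
    qed
  qed
  define W where "W = insert n F - V"
  have "\<exists>w. w < n \<and> lab w = p \<and> w \<notin> S" if "p \<in> W" for p
    using that by (auto simp: W_def V_def vac_def)
  then obtain rep where rep: "\<And>p. p \<in> W \<Longrightarrow> rep p < n \<and> lab (rep p) = p \<and> rep p \<notin> S" by metis
  have injr: "inj_on rep W" using rep by (metis inj_onI)
  have cardW: "card W + card V = card F + 1"
  proof -
    have "V \<subseteq> insert n F" by (auto simp: V_def)
    then have "card W = card (insert n F) - card V"
      unfolding W_def using finV by (simp add: card_Diff_subset)
    moreover have "card V \<le> card (insert n F)"
      using \<open>V \<subseteq> insert n F\<close> finF by (intro card_mono) auto
    ultimately show ?thesis using finF n_F by simp
  qed
  show ?thesis
  proof (rule that[of lab "rep ` W"])
    show "rep ` W \<subseteq> {..<n} - S" using rep by auto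
    show "inj_on lab (rep ` W)" using rep by (auto simp: inj_on_def)
    have cq: "card (rep ` W) = card W" using injr by (rule card_image)
    show "card C + 1 \<le> 2 * card (rep ` W)" using cq cardW cardV cardF by simp
    have "0 < card F" using finF F_ne by (simp add: card_gt_0_iff)
    then show "2 \<le> card (rep ` W)"
      using cq cardW cardV small by (cases "card F = 1") auto
  qed (rule lab_const)
qed

end

section \<open>Perfect elimination orders of chordal graphs\<close>

definition walk_in :: "('a \<Rightarrow> 'a \<Rightarrow> bool) \<Rightarrow> 'a set \<Rightarrow> 'a \<Rightarrow> 'a \<Rightarrow> 'a list \<Rightarrow> bool" where
  "walk_in E W x y xs \<longleftrightarrow> xs \<noteq> [] \<and> hd xs = x \<and> last xs = y \<and> set xs \<subseteq> W \<and> successively E xs"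

lemma successively_take_drop:
  "successively E xs \<Longrightarrow> successively E (take i xs) \<and> successively E (drop i xs)"
  using successively_append_iff[of E "take i xs" "drop i xs"] by simp

text \<open>The case \<open>j = length xs\<close> truncates a walk that has reached its goal already.\<close>

lemma walk_in_shortcut:
  assumes w: "walk_in E W x y xs" and ij: "i < j" "j \<le> length xs"
    and link: "j < length xs \<Longrightarrow> E (xs ! i) (xs ! j)" "j = length xs \<Longrightarrow> xs ! i = y"
  shows "walk_in E W x y (take (Suc i) xs @ drop j xs)"
proof -
  have i: "i < length xs" using ij by simp
  have ne: "take (Suc i) xs \<noteq> []" using i by auto
  have last: "last (take (Suc i) xs) = xs ! i" using i by (simp add: take_Suc_conv_app_nth)
  have "set (take (Suc i) xs @ drop j xs) \<subseteq> set xs"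
    using set_take_subset[of "Suc i" xs] set_drop_subset[of j xs] by auto
  moreover have "successively E (take (Suc i) xs @ drop j xs)"
  proof (cases "j < length xs")
    case True
    then show ?thesis unfolding successively_append_iff
      using w successively_take_drop[of E xs] last link(1)
      by (simp add: walk_in_def hd_drop_conv_nth)
  next
    case False
    then show ?thesis using w successively_take_drop[of E xs] by (simp add: walk_in_def)
  qed
  moreover have "last (take (Suc i) xs @ drop j xs) = y"
    using w last link(2) ij(2) by (cases "j = length xs") (auto simp: walk_in_def last_append)
  ultimately show ?thesis using w ne by (auto simp: walk_in_def hd_append)
qed

text \<open>A shortest walk repeats no vertex and has no shortcut.\<close>

lemma induced_walk:
  assumes "walk_in E W x y xs0"
  shows "\<exists>xs. walk_in E W x y xs \<and> distinct xs \<and>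
    (\<forall>i j. i < j \<longrightarrow> j < length xs \<longrightarrow> E (xs ! i) (xs ! j) \<longrightarrow> j = Suc i)"
proof -
  obtain xs where xs: "walk_in E W x y xs" and least: "\<And>ys. walk_in E W x y ys \<Longrightarrow> length xs \<le> length ys"
    using ex_has_least_nat[of "walk_in E W x y" xs0 length] assms by blast
  have short: False
    if "Suc i < j" "j \<le> length xs" "j < length xs \<Longrightarrow> E (xs ! i) (xs ! j)"
      "j = length xs \<Longrightarrow> xs ! i = y" for i j
    using least[OF walk_in_shortcut[OF xs, of i j]] that by simp
  have "distinct xs"
  proof (rule ccontr)
    assume "\<not> distinct xs"
    then obtain i j where ij: "i < j" "j < length xs" "xs ! i = xs ! j"
      by (metis distinct_conv_nth nat_neq_iff)
    show False
    proof (rule short[of i "Suc j"])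
      assume "Suc j < length xs"
      then show "E (xs ! i) (xs ! Suc j)"
        using xs ij(3) successively_nth[of E xs j] by (simp add: walk_in_def)
    next
      assume "Suc j = length xs"
      then have "length xs - 1 = j" by simp
      moreover have "last xs = y" "xs \<noteq> []" using xs by (auto simp: walk_in_def)
      ultimately show "xs ! i = y" using ij(3) last_conv_nth[of xs] by simp
    qed (use ij in auto)
  qed
  moreover have "j = Suc i" if "i < j" "j < length xs" "E (xs ! i) (xs ! j)" for i j
    using short[of i j] that by (cases "Suc i < j") auto
  ultimately show ?thesis using xs by blast
qed

text \<open>
  Cycles are lists of distinct vertices here; the excluded positions are those of consecutive
  vertices, including the last and the first one.
\<close>

definition chordal_on :: "'a set \<Rightarrow> ('a \<Rightarrow> 'a \<Rightarrow> bool) \<Rightarrow> bool" where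
  "chordal_on V E \<longleftrightarrow> (\<forall>xs. distinct xs \<and> set xs \<subseteq> V \<and> 4 \<le> length xs \<and>
     successively E xs \<and> E (last xs) (hd xs) \<longrightarrow>
     (\<exists>i j. i < j \<and> j < length xs \<and> E (xs ! i) (xs ! j) \<and> j \<noteq> Suc i \<and> \<not> (i = 0 \<and> Suc j = length xs)))"

definition clique_on :: "('a \<Rightarrow> 'a \<Rightarrow> bool) \<Rightarrow> 'a set \<Rightarrow> bool" where
  "clique_on E K \<longleftrightarrow> (\<forall>a\<in>K. \<forall>b\<in>K. a \<noteq> b \<longrightarrow> E a b)"

definition simplicial_in :: "('a \<Rightarrow> 'a \<Rightarrow> bool) \<Rightarrow> 'a set \<Rightarrow> 'a \<Rightarrow> bool" where
  "simplicial_in E W w \<longleftrightarrow> clique_on E {a \<in> W. E w a}"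

locale chordal_graph =
  fixes V :: "'a set" and E :: "'a \<Rightarrow> 'a \<Rightarrow> bool"
  assumes finite_V: "finite V" and sym: "E x y \<Longrightarrow> E y x" and irrefl: "\<not> E x x"
    and chordal: "chordal_on V E"
begin

definition component :: "'a set \<Rightarrow> 'a \<Rightarrow> 'a set" where
  "component X z = {w. (z, w) \<in> {(a, b). a \<in> X \<and> b \<in> X \<and> E a b}\<^sup>*}"

lemma component_self: "z \<in> component X z"
  by (simp add: component_def)

lemma component_sub: "z \<in> X \<Longrightarrow> component X z \<subseteq> X"
  by (auto simp: component_def elim: rtranclE)

lemma component_step: "z \<in> X \<Longrightarrow> a \<in> component X z \<Longrightarrow> b \<in> X \<Longrightarrow> E a b \<Longrightarrow> b \<in> component X z"
  using component_sub[of z X] by (auto simp: component_def intro: rtrancl_into_rtrancl)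

lemma component_walk:
  assumes z: "z \<in> X" and a: "a \<in> component X z" and b: "b \<in> component X z"
  shows "\<exists>xs. walk_in E (component X z) a b xs"
proof -
  let ?r = "{(a, b). a \<in> X \<and> b \<in> X \<and> E a b}"
  have "sym ?r" using sym by (auto simp: sym_def)
  then have "(a, z) \<in> ?r\<^sup>*" using a sym_rtrancl[of ?r] by (auto simp: component_def dest: symD)
  then have "(a, b) \<in> ?r\<^sup>*" using b by (auto simp: component_def)
  then show ?thesis
  proof (induction rule: rtrancl_induct)
    case base
    then show ?case using a by (intro exI[of _ "[a]"]) (auto simp: walk_in_def)
  next
    case (step c d)
    then obtain xs where xs: "walk_in E (component X z) a c xs" by blast
    then have "c \<in> component X z" by (auto simp: walk_in_def)
    then have "d \<in> component X z" using component_step[OF z] step.hyps(2) by auto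
    then have "walk_in E (component X z) a d (xs @ [d])"
      using xs step.hyps(2) by (auto simp: walk_in_def successively_append_iff)
    then show ?case by blast
  qed
qed

text \<open>
  Two nonadjacent neighbours \<open>x\<close>, \<open>y\<close> of the component are neighbours of \<open>u\<close>. A shortest walk
  between them through the component closes up with \<open>u\<close> to a cycle without chord, because \<open>u\<close>
  has no neighbours in the component.
\<close>

lemma separator_clique:
  assumes W: "W \<subseteq> V" and u: "u \<in> W" and z: "z \<in> W" "z \<noteq> u" "\<not> E u z"
  defines "X \<equiv> {w \<in> W. w \<noteq> u \<and> \<not> E u w}"
  shows "clique_on E {s \<in> W. s \<notin> component X z \<and> (\<exists>c\<in>component X z. E s c)}" (is "clique_on E ?S")
  unfolding clique_on_def
proof (intro ballI impI, rule ccontr)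
  fix x y assume xy: "x \<in> ?S" "y \<in> ?S" "x \<noteq> y" "\<not> E x y"
  let ?C = "component X z"
  have zX: "z \<in> X" using z by (simp add: X_def)
  have CX: "?C \<subseteq> X" by (rule component_sub[OF zX])
  have nbr: "E u s \<and> s \<noteq> u" if "s \<in> ?S" for s
  proof -
    obtain c where c: "c \<in> ?C" "E s c" "s \<notin> ?C" "s \<in> W" using \<open>s \<in> ?S\<close> by blast
    have "s \<notin> X" using component_step[OF zX c(1)] sym[OF c(2)] c(3) by blast
    moreover have "s \<noteq> u" using c CX by (auto simp: X_def)
    ultimately show ?thesis using c(4) by (auto simp: X_def)
  qed
  obtain a b where ab: "a \<in> ?C" "E x a" "b \<in> ?C" "E y b" using xy by blast
  obtain xs0 where "walk_in E ?C a b xs0" using component_walk[OF zX ab(1,3)] by blast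
  then have "walk_in E (insert x (insert y ?C)) x y (x # xs0 @ [y])"
    using ab sym by (auto simp: walk_in_def successively_append_iff successively_Cons)
  then obtain xs where xs: "walk_in E (insert x (insert y ?C)) x y xs" "distinct xs"
    and ind: "\<And>i j. i < j \<Longrightarrow> j < length xs \<Longrightarrow> E (xs ! i) (xs ! j) \<Longrightarrow> j = Suc i"
    using induced_walk by metis
  have ne: "xs \<noteq> []" and ends: "hd xs = x" "last xs = y" and set: "set xs \<subseteq> insert x (insert y ?C)"
    and succ: "successively E xs" using xs by (auto simp: walk_in_def)
  have len: "3 \<le> length xs"
  proof (rule ccontr)
    assume "\<not> 3 \<le> length xs"
    then have "length xs = 1 \<or> length xs = 2" using ne by (cases "length xs") auto
    then consider p where "xs = [p]" | p q where "xs = [p, q]"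
      by (auto simp: length_Suc_conv numeral_2_eq_2)
    then show False
    proof cases
      case 1
      then show ?thesis using ends xy(3) by simp
    next
      case 2
      then show ?thesis using ends succ xy(4) by simp
    qed
  qed
  have "u \<notin> ?C" using CX by (auto simp: X_def)
  then have u_xs: "u \<notin> set xs" using set nbr[OF xy(1)] nbr[OF xy(2)] by blast
  have "distinct (u # xs)" "4 \<le> length (u # xs)" using xs(2) u_xs len by auto
  moreover have "set (u # xs) \<subseteq> V"
  proof -
    have "x \<in> W" "y \<in> W" "?C \<subseteq> W" using xy(1,2) CX by (auto simp: X_def)
    then show ?thesis using set W u by auto
  qed
  moreover have "successively E (u # xs)" using succ ends nbr[OF xy(1)] ne by (auto simp: successively_Cons)
  moreover have "E (last (u # xs)) (hd (u # xs))" using ne ends sym nbr[OF xy(2)] by auto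
  ultimately obtain i j where ij: "i < j" "j < length (u # xs)" "E ((u # xs) ! i) ((u # xs) ! j)"
    "j \<noteq> Suc i" "\<not> (i = 0 \<and> Suc j = length (u # xs))"
    using chordal unfolding chordal_on_def by meson
  obtain j' where j': "j = Suc j'" using ij(1) by (cases j) auto
  show False
  proof (cases i)
    case (Suc i')
    then show ?thesis using ind[of i' j'] ij j' by simp
  next
    case 0
    then have j'2: "E u (xs ! j')" "0 < j'" "Suc j' < length xs" using ij j' by auto
    have "xs ! j' \<notin> ?C" using j'2(1) CX by (auto simp: X_def)
    moreover have "xs ! j' \<in> set xs" using j'2(3) by simp
    ultimately have "xs ! j' \<in> {x, y}" using set by blast
    moreover have "xs ! j' \<noteq> xs ! 0" "xs ! j' \<noteq> xs ! (length xs - 1)"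
      using nth_eq_iff_index_eq[OF xs(2), of j' 0] nth_eq_iff_index_eq[OF xs(2), of j' "length xs - 1"]
        j'2(2,3) ne by simp_all
    ultimately show ?thesis using ends ne by (auto simp: hd_conv_nth last_conv_nth)
  qed
qed

text \<open>
  A form of Dirac's theorem that supports its own induction. If some \<open>u\<close>, chosen in \<open>K\<close> if
  possible, has a non-neighbour \<open>z\<close>, then the component \<open>C\<close> of \<open>z\<close> among the non-neighbours of
  \<open>u\<close> has a clique \<open>S\<close> as boundary. A vertex of \<open>C\<close> that is simplicial in \<open>C \<union> S\<close> is
  simplicial in \<open>W\<close>, and it is outside the clique \<open>K\<close>, whose vertices are adjacent to \<open>u\<close>. If
  every vertex of \<open>K\<close> is adjacent to all others, one of them may be deleted.
\<close>

lemma simplicial_exists: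
  "W \<subseteq> V \<Longrightarrow> K \<subset> W \<Longrightarrow> clique_on E K \<Longrightarrow> \<exists>w\<in>W - K. simplicial_in E W w"
proof (induction "card W" arbitrary: W K rule: less_induct)
  case less
  have finW: "finite W" using less.prems(1) finite_V finite_subset by blast
  show ?case
  proof (cases "clique_on E W")
    case True
    then show ?thesis using less.prems(2) by (auto simp: simplicial_in_def clique_on_def)
  next
    case False
    then obtain a b where ab: "a \<in> W" "b \<in> W" "a \<noteq> b" "\<not> E a b" by (auto simp: clique_on_def)
    show ?thesis
    proof (cases "\<exists>u z. u \<in> W \<and> z \<in> W \<and> z \<noteq> u \<and> \<not> E u z \<and> (K = {} \<or> u \<in> K)")
      case True
      then obtain u z where uz: "u \<in> W" "z \<in> W" "z \<noteq> u" "\<not> E u z" "K = {} \<or> u \<in> K" by blast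
      define X where "X = {w \<in> W. w \<noteq> u \<and> \<not> E u w}"
      define C where "C = component X z"
      define S where "S = {s \<in> W. s \<notin> C \<and> (\<exists>c\<in>C. E s c)}"
      have zX: "z \<in> X" using uz by (simp add: X_def)
      have CX: "C \<subseteq> X" using component_sub[OF zX] by (simp add: C_def)
      have S: "clique_on E S"
        using separator_clique[OF less.prems(1) uz(1-4)] by (simp add: S_def C_def X_def)
      have sub: "C \<union> S \<subseteq> W" using CX by (auto simp: X_def S_def)
      have u_out: "u \<notin> C \<union> S" using CX sym by (auto simp: X_def S_def)
      have "card (C \<union> S) < card W" using sub u_out uz(1) finW by (intro psubset_card_mono) auto
      moreover have "S \<subset> C \<union> S" using component_self[of z X] by (auto simp: C_def S_def)
      ultimately obtain w where w: "w \<in> C \<union> S - S" "simplicial_in E (C \<union> S) w"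
        using less.hyps[of "C \<union> S" S] S sub less.prems(1) by blast
      have wC: "w \<in> C" using w(1) by blast
      have "{a \<in> W. E w a} = {a \<in> C \<union> S. E w a}"
        using wC sub sym by (auto simp: S_def)
      then have "simplicial_in E W w" using w(2) by (simp add: simplicial_in_def)
      moreover have "w \<notin> K"
        using uz(5) less.prems(3) wC CX by (auto simp: X_def clique_on_def)
      ultimately show ?thesis using wC sub by blast
    next
      case no: False
      then obtain k where k: "k \<in> K" using ab by blast
      have kW: "k \<in> W" using k less.prems(2) by blast
      have univ: "E k z" if "z \<in> W" "z \<noteq> k" for z using no k kW that by blast
      have "card (W - {k}) < card W" using kW finW by (meson card_Diff1_less)
      moreover have "K - {k} \<subset> W - {k}" using less.prems(2) k by blast
      moreover have "clique_on E (K - {k})" using less.prems(3) by (auto simp: clique_on_def)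
      ultimately obtain w where w: "w \<in> W - {k} - (K - {k})" "simplicial_in E (W - {k}) w"
        using less.hyps[of "W - {k}" "K - {k}"] less.prems(1) by blast
      then have "simplicial_in E W w"
        using univ sym unfolding simplicial_in_def clique_on_def
        by (metis (no_types, lifting) Diff_iff mem_Collect_eq singletonD)
      then show ?thesis using w(1) by blast
    qed
  qed
qed

text \<open>
  As \<open>{u}\<close> is a clique, a simplicial vertex other than \<open>u\<close> can be removed as long as there is
  one.
\<close>

lemma elimination_ordering_exists:
  "W \<subseteq> V \<Longrightarrow> u \<in> W \<Longrightarrow> \<exists>xs. distinct xs \<and> set xs = W \<and> last xs = u \<and> xs \<noteq> [] \<and>
     (\<forall>i<length xs. simplicial_in E (set (drop i xs)) (xs ! i))"
proof (induction "card W" arbitrary: W rule: less_induct)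
  case less
  have finW: "finite W" using less.prems(1) finite_V finite_subset by blast
  show ?case
  proof (cases "W = {u}")
    case True
    then show ?thesis using irrefl by (intro exI[of _ "[u]"]) (auto simp: simplicial_in_def clique_on_def)
  next
    case False
    then obtain w where w: "w \<in> W - {u}" "simplicial_in E W w"
      using simplicial_exists[OF less.prems(1), of "{u}"] less.prems(2) by (auto simp: clique_on_def)
    have "card (W - {w}) < card W" using w(1) finW by (meson DiffD1 card_Diff1_less)
    then obtain xs where xs: "distinct xs" "set xs = W - {w}" "last xs = u" "xs \<noteq> []"
      "\<forall>i<length xs. simplicial_in E (set (drop i xs)) (xs ! i)"
      using less.hyps[of "W - {w}"] less.prems w(1) by blast
    have "\<forall>i<length (w # xs). simplicial_in E (set (drop i (w # xs))) ((w # xs) ! i)"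
    proof (intro allI impI)
      fix i assume i: "i < length (w # xs)"
      have "set (w # xs) = W" using xs(2) w(1) by auto
      then show "simplicial_in E (set (drop i (w # xs))) ((w # xs) ! i)"
        using xs(5) w(2) i by (cases i) auto
    qed
    then show ?thesis using xs w(1) by (intro exI[of _ "w # xs"]) auto
  qed
qed

end

section \<open>From toughness to Hamilton paths\<close>

text \<open>
  A vertex \<open>i\<close> without later neighbours is separated, with all vertices from which it can be
  reached upwards, from the others. This is used to show that toughness makes an elimination
  order connected.
\<close>

lemma isolated_label:
  fixes N :: "nat \<Rightarrow> nat set"
  assumes later: "\<And>x y. y \<in> N x \<Longrightarrow> x < y \<and> y < n"
    and clique: "\<And>x y z. y \<in> N x \<Longrightarrow> z \<in> N x \<Longrightarrow> y < z \<Longrightarrow> z \<in> N y"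
    and i: "N i = {}" and xy: "y \<in> N x"
  shows "(x, i) \<in> {(a, b). b \<in> N a}\<^sup>* \<longleftrightarrow> (y, i) \<in> {(a, b). b \<in> N a}\<^sup>*" (is "_ \<in> ?r\<^sup>* \<longleftrightarrow> _")
proof
  assume "(x, i) \<in> ?r\<^sup>*"
  then show "(y, i) \<in> ?r\<^sup>*" using xy
  proof (induction "n - x" arbitrary: x y rule: less_induct)
    case less
    have "x \<noteq> i" using less.prems(2) i by auto
    then obtain b where b: "b \<in> N x" "(b, i) \<in> ?r\<^sup>*"
      using less.prems(1) by (auto elim: converse_rtranclE)
    consider "y = b" | "y < b" | "b < y" by linarith
    then show ?case
    proof cases
      case 2
      then have "(y, b) \<in> ?r" using clique[OF less.prems(2) b(1)] by simp
      then show ?thesis using b(2) by (rule converse_rtrancl_into_rtrancl)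
    next
      case 3
      then have "y \<in> N b" using clique[OF b(1) less.prems(2)] by simp
      moreover have "n - b < n - x" using later[OF b(1)] by linarith
      ultimately show ?thesis using less.hyps b(2) by blast
    qed (use b in simp)
  qed
next
  assume "(y, i) \<in> ?r\<^sup>*"
  moreover have "(x, y) \<in> ?r" using xy by simp
  ultimately show "(x, i) \<in> ?r\<^sup>*" by (rule converse_rtrancl_into_rtrancl[rotated])
qed

context two_ends
begin

text \<open>
  Toughness is expressed by labels that are constant on the components and a set \<open>Q\<close> of
  vertices in different components, so that components need not be counted. An empty slot
  would lead to \<open>2 * card C + 2 \<le> 4 * card Q \<le> card S \<le> 2 * card C + 1\<close>.
\<close>

lemma hamilton_path_if_tough:
  assumes tough: "\<And>S (lab :: nat \<Rightarrow> nat) Q. (\<And>x y. y \<in> N x \<Longrightarrow> x \<notin> S \<Longrightarrow> y \<notin> S \<Longrightarrow> lab x = lab y) \<Longrightarrow>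
     S \<subseteq> {..<n} \<Longrightarrow> Q \<subseteq> {..<n} - S \<Longrightarrow> inj_on lab Q \<Longrightarrow> 2 \<le> card Q \<Longrightarrow> 4 * card Q \<le> card S"
  shows "\<exists>p. p \<noteq> [] \<and> distinct p \<and> set p = {..<n} \<and> hd p = v \<and> last p = n - 1 \<and>
    successively (\<lambda>x y. y \<in> N x \<or> x \<in> N y) p"
proof -
  obtain A P g bs where "plan n N v n A P g bs" using plan_exists by blast
  then interpret plan n N v n A P g bs .
  interpret full_plan n N v A P g bs by unfold_locales
  obtain M where M: "matching (cand g) (slots P n) A M" using matchable_A by (auto simp: matchable_def)
  show ?thesis
  proof (cases "slots P n \<subseteq> M ` A")
    case True
    then show ?thesis by (rule spanning_path[OF M])
  next
    case False
    then obtain s0 where s0: "s0 \<in> slots P n" "s0 \<notin> M ` A" by blast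
    obtain C h where C: "C \<subseteq> {c. c < R \<and> par c \<notin> P}" "C \<noteq> {}" "\<And>c. c \<in> C \<Longrightarrow> \<exists>i. h c = g c i"
      "card (\<Union>c\<in>C. N (h c)) \<le> 2 * card C + 1"
      using deficient_cut[OF M s0] by blast
    obtain lab :: "nat \<Rightarrow> nat" and Q where lab: "\<And>x y. y \<in> N x \<Longrightarrow> x \<notin> (\<Union>c\<in>C. N (h c)) \<Longrightarrow>
        y \<notin> (\<Union>c\<in>C. N (h c)) \<Longrightarrow> lab x = lab y"
      "Q \<subseteq> {..<n} - (\<Union>c\<in>C. N (h c))" "inj_on lab Q" "2 \<le> card Q" "card C + 1 \<le> 2 * card Q"
      using cut_pieces[OF C(1-3)] by blast
    have "4 * card Q \<le> card (\<Union>c\<in>C. N (h c))"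
      by (rule tough[OF lab(1) _ lab(2-4)]) (use later in auto)
    then show ?thesis using C(4) lab(5) by linarith
  qed
qed

end

lemma (in wf_digraph) awalk_along:
  assumes "xs \<noteq> []" "set xs \<subseteq> verts G" "successively (\<lambda>x y. x \<rightarrow>\<^bsub>G\<^esub> y) xs"
  shows "\<exists>p. awalk (hd xs) p (last xs) \<and> awalk_verts (hd xs) p = xs"
  using assms
proof (induction xs rule: induct_list012)
  case (2 x)
  then show ?case by (intro exI[of _ "[]"]) (simp add: awalk_Nil_iff)
next
  case (3 x y zs)
  then obtain p where p: "awalk y p (last (y # zs))" "awalk_verts y p = y # zs" by auto
  obtain e where e: "e \<in> arcs G" "tail G e = x" "head G e = y"
    using 3(5) by (auto simp: arcs_ends_conv)
  then show ?case using p by (intro exI[of _ "e # p"]) (simp add: awalk_Cons_iff)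
qed simp

text \<open>
  The closed arc walk along a list of vertices visits the vertices of the list as tails. Its
  arcs join consecutive vertices, so a chord joins vertices that are not consecutive.
\<close>

lemma (in graph) chordal_on_if_chordal:
  assumes "chordal G" shows "chordal_on (verts G) (\<lambda>x y. x \<rightarrow>\<^bsub>G\<^esub> y)"
  unfolding chordal_on_def
proof (intro allI impI, elim conjE)
  fix xs assume xs: "distinct xs" "set xs \<subseteq> verts G" "4 \<le> length xs"
    "successively (\<lambda>x y. x \<rightarrow>\<^bsub>G\<^esub> y) xs" "last xs \<rightarrow>\<^bsub>G\<^esub> hd xs"
  have ne: "xs \<noteq> []" using xs(3) by auto
  have "successively (\<lambda>x y. x \<rightarrow>\<^bsub>G\<^esub> y) (xs @ [hd xs])"
    using xs(4,5) by (simp add: successively_append_iff)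
  then obtain p where p: "awalk (hd xs) p (hd xs)" "awalk_verts (hd xs) p = xs @ [hd xs]"
    using awalk_along[of "xs @ [hd xs]"] xs(2) ne subsetD[OF xs(2) hd_in_set[OF ne]] by auto
  have pne: "p \<noteq> []" using p(2) ne by auto
  then have tails: "map (tail G) p = xs" using p(2) by (simp add: awalk_verts_conv)
  have len: "length p = length xs" using tails by (metis length_map)
  have "awalk_verts (hd xs) p = tail G (hd p) # map (head G) p"
    using awalk_verts_conv'[of "hd xs" p "hd xs"] p(1) pne by (simp add: awalk_def)
  then have heads: "head G (p ! k) = (xs @ [hd xs]) ! Suc k" if "k < length xs" for k
    using p(2) that len by simp
  have ends: "(xs ! k, (xs @ [hd xs]) ! Suc k) \<in> arc_to_ends G ` set p" if "k < length xs" for k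
  proof
    show "p ! k \<in> set p" using that len by simp
    have "xs ! k = tail G (p ! k)" using that len tails by (metis nth_map)
    then show "(xs ! k, (xs @ [hd xs]) ! Suc k) = arc_to_ends G (p ! k)"
      using heads[OF that] by (simp add: arc_to_ends_def)
  qed
  have "distinct (tl (awalk_verts (hd xs) p))"
    using xs(1) p(2) ne by (cases xs) auto
  then have "cycle p" using p(1) pne by (auto simp: cycle_def)
  then obtain u w where uw: "chord G p u w" using assms len xs(3) by (auto simp: chordal_def)
  have "tail G ` set p = set xs" using tails by (metis set_map)
  then have uw_xs: "u \<in> set xs" "w \<in> set xs" and uwG: "u \<rightarrow>\<^bsub>G\<^esub> w"
    and no: "(u, w) \<notin> arc_to_ends G ` set p" "(w, u) \<notin> arc_to_ends G ` set p"
    using uw by (auto simp: chord_def)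
  have wu: "w \<rightarrow>\<^bsub>G\<^esub> u" using arcs_ends_symmetric[OF sym_arcs uwG] .
  have "u \<noteq> w" using uwG no_loops by (auto simp: arcs_ends_conv)
  then obtain i j where ij: "i < j" "j < length xs" "xs ! i \<rightarrow>\<^bsub>G\<^esub> xs ! j"
    "(xs ! i, xs ! j) \<notin> arc_to_ends G ` set p" "(xs ! j, xs ! i) \<notin> arc_to_ends G ` set p"
    using uw_xs uwG wu no by (metis in_set_conv_nth nat_neq_iff)
  have "j \<noteq> Suc i" using ends[of i] ij(1,2,4) by (auto simp: nth_append)
  moreover have "\<not> (i = 0 \<and> Suc j = length xs)"
    using ends[of j] ij(2,5) ne by (auto simp: nth_append hd_conv_nth)
  ultimately show "\<exists>i j. i < j \<and> j < length xs \<and> xs ! i \<rightarrow>\<^bsub>G\<^esub> xs ! j \<and> j \<noteq> Suc i \<and>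
      \<not> (i = 0 \<and> Suc j = length xs)" using ij(1-3) by blast
qed

text \<open>
  Vertices with different labels lie in different strong components of the rest, which are its
  components.
\<close>

lemma (in graph) card_le_if_tough:
  assumes tough: "tough t G" "0 \<le> t" and S: "S \<subseteq> verts G"
    and lab: "\<And>x y. x \<rightarrow>\<^bsub>G\<^esub> y \<Longrightarrow> x \<notin> S \<Longrightarrow> y \<notin> S \<Longrightarrow> lab x = lab y"
    and Q: "Q \<subseteq> verts G - S" "inj_on lab Q" "2 \<le> card Q"
  shows "t * real (card Q) \<le> real (card S)"
proof -
  let ?H = "G \<restriction> (verts G - S)"
  interpret H: sym_digraph ?H
    by (rule induced_graph_imp_graph) (rule induced_induce, blast)
  interpret H: fin_digraph ?H
    by (rule fin_digraph_subgraph[OF induced_imp_subgraph[OF induced_induce]]) blast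
  have vH: "verts ?H = verts G - S" by simp
  have same: "lab x = lab y" if "x \<rightarrow>\<^sup>*\<^bsub>?H\<^esub> y" for x y
    using that
  proof (induction rule: H.reachable_induct)
    case (step y z)
    then have "y \<rightarrow>\<^bsub>G\<^esub> z" "y \<notin> S" "z \<notin> S" by (auto simp: arcs_ends_conv)
    then show ?case using step lab by metis
  qed simp
  have "inj_on H.scc_of Q"
  proof (rule inj_onI)
    fix x y assume xy: "x \<in> Q" "y \<in> Q" "H.scc_of x = H.scc_of y"
    then have "y \<in> H.scc_of x" using H.in_scc_of_self[of y] Q(1) by auto
    then have "lab x = lab y" using same by (auto simp: H.scc_of_def)
    then show "x = y" using Q(2) xy by (auto dest: inj_onD)
  qed
  then have "card Q = card (H.scc_of ` Q)" by (simp add: card_image)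
  also have "\<dots> \<le> card H.sccs_verts"
    using H.scc_of_in_sccs_verts Q(1) by (intro card_mono H.finite_sccs_verts) auto
  also have "\<dots> = num_components ?H"
    using H.card_sccs_verts by (simp add: num_components_def H.components_of_eq_sccs)
  finally have le: "card Q \<le> num_components ?H" .
  then have "t * real (num_components ?H) \<le> real (card S)"
    using tough(1) S Q(3) by (simp add: tough_def)
  moreover have "t * real (card Q) \<le> t * real (num_components ?H)"
    using le tough(2) by (intro mult_left_mono) auto
  ultimately show ?thesis by linarith
qed

text \<open>
  The elimination order is taken with \<open>b\<close> as last vertex, and vertices are replaced by their
  positions in it. Toughness for the empty cut makes it connected: otherwise the vertices that
  lead up to some \<open>i\<close> without later neighbours and the vertex \<open>n - 1\<close> would lie in different
  components.
\<close>

lemma (in graph) hamilton_path_exists: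
  assumes "chordal G" "tough t G" "4 \<le> t" and ab: "a \<in> verts G" "b \<in> verts G" "a \<noteq> b"
  shows "\<exists>p. hamilton_path G a p b"
proof -
  let ?E = "\<lambda>x y. x \<rightarrow>\<^bsub>G\<^esub> y"
  have sym: "?E y x" if "?E x y" for x y using arcs_ends_symmetric[OF sym_arcs that] .
  have irrefl: "\<not> ?E x x" for x using no_loops by (auto simp: arcs_ends_conv)
  interpret C: chordal_graph "verts G" ?E
    by unfold_locales (use chordal_on_if_chordal[OF assms(1)] sym irrefl in auto)
  obtain xs where xs: "distinct xs" "set xs = verts G" "last xs = b" "xs \<noteq> []"
    and simplicial: "\<And>i. i < length xs \<Longrightarrow> simplicial_in ?E (set (drop i xs)) (xs ! i)"
    using C.elimination_ordering_exists[of "verts G" b] ab(2) by blast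
  define n where "n = length xs"
  define N where "N i = {j. i < j \<and> j < n \<and> ?E (xs ! i) (xs ! j)}" for i
  obtain v where v_index: "v < n" "xs ! v = a" using ab(1) xs(2) by (metis in_set_conv_nth n_def)
  have last: "xs ! (n - 1) = b" using xs(3,4) by (simp add: last_conv_nth n_def)
  have inj: "inj_on ((!) xs) {..<n}" using xs(1) by (auto simp: inj_on_nth n_def)
  have bij: "(!) xs ` {..<n} = verts G" using xs(2) by (auto simp: set_conv_nth n_def)
  have v_less: "Suc v < n" using v_index last ab(3) by (cases "Suc v = n") auto
  have edge: "xs ! i \<rightarrow>\<^bsub>G\<^esub> xs ! j \<longleftrightarrow> j \<in> N i \<or> i \<in> N j" if "i < n" "j < n" for i j
    using that sym irrefl[of "xs ! i"] by (cases i j rule: linorder_cases) (auto simp: N_def)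
  have later: "i < j \<and> j < n" if "j \<in> N i" for i j using that by (simp add: N_def)
  have clique: "k \<in> N j" if "j \<in> N i" "k \<in> N i" "j < k" for i j k
  proof -
    have in_drop: "xs ! l \<in> set (drop i xs)" if "l \<in> N i" for l
    proof -
      have "i < l" "l < length xs" using later[OF that] by (auto simp: n_def)
      then show ?thesis using nth_mem[of "l - i" "drop i xs"] diff_less_mono[of l "length xs" i] by simp
    qed
    have i: "i < length xs" using later[OF that(1)] by (simp add: n_def)
    have "xs ! j \<noteq> xs ! k" using later[OF that(2)] that(3) xs(1) by (auto simp: nth_eq_iff_index_eq n_def)
    then have "?E (xs ! j) (xs ! k)"
      using simplicial[OF i] in_drop[OF that(1)] in_drop[OF that(2)] that(1,2)
      by (auto simp: simplicial_in_def clique_on_def N_def)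
    then show ?thesis using later[OF that(2)] that(3) by (simp add: N_def)
  qed
  have tough: "4 * card Q \<le> card S"
    if lab: "\<And>x y. y \<in> N x \<Longrightarrow> x \<notin> S \<Longrightarrow> y \<notin> S \<Longrightarrow> lab x = lab y"
      and S: "S \<subseteq> {..<n}" and Q: "Q \<subseteq> {..<n} - S" "inj_on lab Q" "2 \<le> card Q"
    for S Q and lab :: "nat \<Rightarrow> nat"
  proof -
    let ?f = "(!) xs"
    let ?lab = "\<lambda>x. lab (the_inv_into {..<n} ?f x)"
    have inv: "the_inv_into {..<n} ?f (xs ! i) = i" if "i < n" for i
      using the_inv_into_f_f[OF inj] that by simp
    have card_Q: "card (?f ` Q) = card Q" and card_S: "card (?f ` S) = card S"
      using inj Q(1) S by (auto intro!: card_image inj_on_subset[OF inj])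
    have mem: "xs ! i \<in> ?f ` S \<longleftrightarrow> i \<in> S" if "i < n" for i
      using inj_on_image_mem_iff[OF inj] S that by auto
    have "t * real (card (?f ` Q)) \<le> real (card (?f ` S))"
    proof (rule card_le_if_tough[OF assms(2), where lab = ?lab])
      show "?f ` S \<subseteq> verts G" using S bij by blast
      show "?f ` Q \<subseteq> verts G - ?f ` S"
      proof
        fix x assume "x \<in> ?f ` Q"
        then obtain i where i: "i \<in> Q" "x = xs ! i" by blast
        then have "i < n" "i \<notin> S" using Q(1) by auto
        then show "x \<in> verts G - ?f ` S" using mem[of i] i(2) bij by auto
      qed
      show "inj_on ?lab (?f ` Q)"
      proof (rule inj_onI)
        fix x y assume "x \<in> ?f ` Q" "y \<in> ?f ` Q" and eq: "?lab x = ?lab y"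
        then obtain i j where "x = xs ! i" "y = xs ! j" "i \<in> Q" "j \<in> Q" by blast
        moreover from this have "i < n" "j < n" using Q(1) by auto
        ultimately show "x = y" using eq inv[of i] inv[of j] inj_onD[OF Q(2), of i j] by simp
      qed
      fix x y assume xy: "?E x y" "x \<notin> ?f ` S" "y \<notin> ?f ` S"
      then have "x \<in> verts G" "y \<in> verts G" by (auto simp: arcs_ends_conv)
      then obtain i j where ij: "x = xs ! i" "i < n" "y = xs ! j" "j < n" using bij by blast
      then have "j \<in> N i \<or> i \<in> N j" using edge[of i j] xy(1) by simp
      moreover have "i \<notin> S" "j \<notin> S" using xy(2,3) ij by auto
      ultimately show "?lab x = ?lab y" using lab[of i j] lab[of j i] ij inv[of i] inv[of j] by auto
    qed (use Q(3) card_Q assms(3) in auto)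
    moreover have "4 * real (card Q) \<le> t * real (card Q)"
      using assms(3) by (rule mult_right_mono) simp
    ultimately have "real (4 * card Q) \<le> real (card S)" using card_Q card_S by simp
    then show ?thesis by (simp only: of_nat_le_iff)
  qed
  have nonempty: "N i \<noteq> {}" if i: "Suc i < n" for i
  proof
    assume N: "N i = {}"
    define r where "r = {(x, y). y \<in> N x}"
    define lab where "lab x = (if (x, i) \<in> r\<^sup>* then 1 else 0 :: nat)" for x
    have "lab x = lab y" if "y \<in> N x" for x y
      using isolated_label[of N n, OF later clique N that] by (simp add: lab_def r_def)
    moreover have "lab (n - 1) = 0" "lab i = 1"
    proof -
      have "(n - 1, i) \<notin> r\<^sup>*"
      proof
        assume "(n - 1, i) \<in> r\<^sup>*"
        moreover have "N (n - 1) = {}" using later[of _ "n - 1"] by fastforce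
        ultimately show False using i by (cases rule: converse_rtranclE) (auto simp: r_def)
      qed
      then show "lab (n - 1) = 0" "lab i = 1" by (auto simp: lab_def)
    qed
    ultimately have "4 * card {i, n - 1} \<le> card ({} :: nat set)"
      using i by (intro tough[of "{}" lab]) auto
    then show False using i by simp
  qed
  interpret two_ends n N v
  proof unfold_locales
    show "0 < n" using v_less by simp
    show "x < y \<and> y < n" if "y \<in> N x" for x y by (rule later[OF that])
    show "z \<in> N y" if "y \<in> N x" "z \<in> N x" "y < z" for x y z by (rule clique[OF that])
    show "N x \<noteq> {}" if "Suc x < n" for x by (rule nonempty[OF that])
    show "Suc v < n" by (rule v_less)
  qed
  obtain q where q: "q \<noteq> []" "distinct q" "set q = {..<n}" "hd q = v" "last q = n - 1"
    "successively (\<lambda>x y. y \<in> N x \<or> x \<in> N y) q"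
    using hamilton_path_if_tough tough by blast
  let ?ys = "map ((!) xs) q"
  have "successively (\<lambda>x y. xs ! x \<rightarrow>\<^bsub>G\<^esub> xs ! y) q"
    by (rule successively_mono[OF q(6)]) (use edge q(3) in auto)
  then have "successively ?E ?ys" by (simp add: successively_map)
  moreover have "set ?ys = verts G" using q(3) bij by simp
  ultimately obtain p where p: "awalk (hd ?ys) p (last ?ys)" "awalk_verts (hd ?ys) p = ?ys"
    using awalk_along[of ?ys] q(1) by auto
  have "hd ?ys = a" "last ?ys = b" using q(1,4,5) v_index(2) last by (simp_all add: hd_map last_map)
  moreover have "distinct ?ys" using q(2,3) inj by (simp add: distinct_map)
  ultimately have "hamilton_path G a p b"
    using p \<open>set ?ys = verts G\<close> by (simp add: hamilton_path_def apath_def)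
  then show ?thesis by blast
qed

theorem theorem1p4:
  fixes G :: "('a, 'b) pre_digraph"
  assumes "graph G"
    and "card (verts G) \<ge> 3"
    and "chordal G"
    and "tough 5 G"
  shows "hamilton_connected G"
proof -
  interpret graph G by (rule assms(1))
  show ?thesis using hamilton_path_exists[OF assms(3,4)] by (simp add: hamilton_connected_def)
qed

end
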